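(* Let $\rho>0$ and $\varepsilon>0$. Let $(k_1,v_1),\dots,(k_n,v_n)$ be key-value pairs with $k_i,v_i\in\mathbb{R}^d$, $\|k_i\|_2\le1$, $\|v_i\|_2\le1$, and $\|\sum_{i=1}^n k_i\|_2\le c_0\sqrt d\log n$ for an absolute constant $c_0$. Then there is a sub-collection $(K',V')=\{(k_i,v_i):i\in I'\}$, $I'\subseteq[n]$, of size $|I'|=O\!\left(\frac{\sqrt d}{\varepsilon}e^{\zeta}\right)$ such that simultaneously for all $q\in\mathbb{R}^d$ with $\|q\|_2\le\rho$, \[ \|\mathrm{Attn}(q,K,V)-\mathrm{Attn}(q,K',V')\|_2\le\varepsilon. \]
   Context: For a collection of pairs $(K,V)=\{(k_i,v_i)\}$ and query $q$, $\mathrm{Attn}(q,K,V)=\dfrac{\sum_i e^{q^Tk_i}v_i}{\sum_i e^{q^Tk_i}}$. Here $\zeta=\zeta(\rho):=\rho+\tfrac12\log\rho+o(\log\log\rho)$ is a quantity depending only on $\rho$; the $O(\cdot)$ hides absolute constants. *)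

theory Defs
  imports Complex_Main "HOL-Library.Landau_Symbols"
begin

text \<open>Vectors in R^d are represented as functions nat => real, only the
coordinates 0..d-1 being relevant.\<close>

definition dotp :: "nat \<Rightarrow> (nat \<Rightarrow> real) \<Rightarrow> (nat \<Rightarrow> real) \<Rightarrow> real" where
  "dotp d x y = (\<Sum>j<d. x j * y j)"

definition vnorm :: "nat \<Rightarrow> (nat \<Rightarrow> real) \<Rightarrow> real" where
  "vnorm d x = sqrt (dotp d x x)"

definition attn :: "nat \<Rightarrow> (nat \<Rightarrow> real) \<Rightarrow> (nat \<Rightarrow> nat \<Rightarrow> real) \<Rightarrow> (nat \<Rightarrow> nat \<Rightarrow> real)
                     \<Rightarrow> nat set \<Rightarrow> (nat \<Rightarrow> real)" where
  "attn d q k v I = (\<lambda>j. (\<Sum>i\<in>I. exp (dotp d q (k i)) * v i j) / (\<Sum>i\<in>I. exp (dotp d q (k i))))"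

end

theory Submission
  imports Defs "HOL-Probability.Hoeffding" "HOL-Analysis.L2_Norm"
begin

text \<open>
  The coreset is obtained by repeated halving: if signs \<open>\<sigma>\<close> make the signed sums of
  \<open>exp (q \<bullet> k i)\<close> and \<open>exp (q \<bullet> k i) * v i\<close> at most \<open>D\<close> for all \<open>q\<close> in the ball, then keeping the smaller
  sign class at each of \<open>t\<close> rounds changes numerator and denominator, rescaled by \<open>2 ^ t\<close>, by at
  most \<open>2 ^ t * D\<close>. The denominator is at least \<open>n / 3\<close> by Jensen's inequality, because the keys almost
  sum to zero, so one can halve down to \<open>O (D / \<epsilon>)\<close> pairs.

  Signs with \<open>D = O (exp \<rho> * sqrt (\<rho> * d))\<close> come from the Gram-Schmidt walk, applied to the kernel
  \<open>exp (\<rho> * (x \<bullet> y - 1)) * (v \<bullet> w)\<close>. The walk produces subgaussian signed sums; instead of choosing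
  its steps at random we follow an exponential potential summed over finitely many test
  functionals. The supremum over \<open>q\<close> is reduced to such a finite family without chaining: the
  average of \<open>exp (y \<bullet> k)\<close> over a cube of lattice points \<open>y\<close> around \<open>q\<close> is \<open>exp (q \<bullet> k)\<close> times a factor
  depending on \<open>k\<close> only.

  If \<open>n\<close> is so small compared to \<open>sqrt d * ln n\<close> that the hypothesis on the keys is void, then \<open>d\<close> is
  enormous compared to \<open>exp \<rho> / \<epsilon>\<close>, and halving with greedily chosen signs, whose discrepancy
  \<open>O (exp \<rho> * sqrt n)\<close> does not involve \<open>d\<close>, suffices.
\<close>

subsection \<open>The Gram-Schmidt walk\<close>

text \<open>The moment generating function at \<open>a\<close> of \<open>s - x\<close>, where \<open>s\<close> is a random sign with mean \<open>x\<close>.\<close>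

definition two_point_mgf :: "real \<Rightarrow> real \<Rightarrow> real" where
  "two_point_mgf x a = exp (- (x * a)) * (cosh a + x * sinh a)"

lemma two_point_mgf_eq_1: "\<bar>x\<bar> = 1 \<Longrightarrow> two_point_mgf x a = 1"
  unfolding two_point_mgf_def
  by (auto simp: abs_if cosh_plus_sinh cosh_minus_sinh exp_minus split: if_splits)

lemma cosh_sinh_comb_pos:
  assumes "\<bar>x\<bar> \<le> 1" shows "cosh a + x * sinh a > (0::real)"
proof -
  have "cosh a + x * sinh a = (1 + x) / 2 * exp a + (1 - x) / 2 * exp (- a)"
    by (simp add: cosh_def sinh_def field_simps)
  moreover have "(1 + x) / 2 * exp a \<ge> 0" "(1 - x) / 2 * exp (- a) \<ge> 0" using assms by auto
  moreover have "(1 + x) / 2 * exp a > 0 \<or> (1 - x) / 2 * exp (- a) > 0"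
  proof (cases "x \<ge> 0")
    case True thus ?thesis by (intro disjI1 mult_pos_pos) auto
  next
    case False thus ?thesis by (intro disjI2 mult_pos_pos) auto
  qed
  ultimately show ?thesis by linarith
qed

lemma two_point_mgf_pos: "\<bar>x\<bar> \<le> 1 \<Longrightarrow> two_point_mgf x a > 0"
  unfolding two_point_mgf_def by (simp add: cosh_sinh_comb_pos)

text \<open>Hoeffding's lemma for a sign with mean \<open>x\<close>. Negative \<open>a\<close> is
  reached in \<open>two_point_mgf_le\<close> by flipping the sign.\<close>

lemma two_point_mgf_le_nonneg:
  assumes "\<bar>x\<bar> \<le> 1" "a \<ge> 0"
  shows "two_point_mgf x a \<le> exp (a\<^sup>2 / 2)"
proof -
  \<comment> \<open>\<open>p\<close> is the probability of the sign \<open>1\<close>. Passing from a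
    sign to a 0/1 variable doubles the exponent, hence \<open>2 * a\<close>.\<close>
  define p where "p = (1 + x) / 2"
  have p: "p \<ge> 0" "p \<le> 1" using assms by (auto simp: p_def)
  have "1 + p * (exp (2 * a) - 1) > 0"
  proof -
    have "p * (exp (2 * a) - 1) \<ge> 0" using p assms by auto
    thus ?thesis by linarith
  qed
  moreover have "- (2 * a) * p + ln (1 + p * (exp (2 * a) - 1)) \<le> (2 * a)\<^sup>2 / 8"
    using Hoeffdings_lemma_aux[of "2 * a" p] assms p by simp
  hence "exp (- (2 * a) * p) * exp (ln (1 + p * (exp (2 * a) - 1))) \<le> exp ((2 * a)\<^sup>2 / 8)"
    unfolding exp_add[symmetric] by (simp only: exp_le_cancel_iff)
  ultimately have "exp (- (2 * a) * p) * (1 + p * (exp (2 * a) - 1)) \<le> exp ((2 * a)\<^sup>2 / 8)"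
    by (simp only: exp_ln)
  moreover have "exp (- (2 * a) * p) * (1 + p * (exp (2 * a) - 1)) = two_point_mgf x a"
  proof -
    have "- (2 * a) * p = - (x * a) - a" by (simp add: p_def field_simps)
    hence 1: "exp (- (2 * a) * p) = exp (- (x * a)) * exp (- a)"
      by (metis exp_add diff_conv_add_uminus)
    have "exp (- a) * (1 + p * (exp (2 * a) - 1)) = (1 - p) * exp (- a) + p * (exp (- a) * exp (2 * a))"
      by (simp add: algebra_simps)
    also have "exp (- a) * exp (2 * a) = exp a" by (simp flip: exp_add)
    also have "(1 - p) * exp (- a) + p * exp a = cosh a + x * sinh a"
      by (simp add: p_def cosh_def sinh_def field_simps)
    finally show ?thesis unfolding 1 two_point_mgf_def by (simp add: mult.assoc)
  qed
  ultimately show ?thesis by (simp add: power2_eq_square)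
qed

lemma two_point_mgf_le:
  assumes "\<bar>x\<bar> \<le> 1"
  shows "two_point_mgf x a \<le> exp (a\<^sup>2 / 2)"
proof (cases "a \<ge> 0")
  case True thus ?thesis using assms by (rule two_point_mgf_le_nonneg[rotated])
next
  case False
  have "two_point_mgf x a = two_point_mgf (- x) (- a)"
    by (simp add: two_point_mgf_def)
  thus ?thesis using two_point_mgf_le_nonneg[of "- x" "- a"] assms False by simp
qed

lemma abs_sinh_le: "\<bar>sinh a\<bar> \<le> \<bar>a\<bar> * cosh (a::real)"
proof -
  have pos: "sinh a \<le> a * cosh a" if "a \<ge> 0" for a :: real
  proof -
    have "(\<lambda>a. a * cosh a - sinh a) 0 \<le> (\<lambda>a. a * cosh a - sinh a) a"
    proof (rule DERIV_nonneg_imp_nondecreasing[OF that])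
      fix x :: real assume "0 \<le> x"
      have "((\<lambda>a. a * cosh a - sinh a) has_real_derivative x * sinh x) (at x)"
        by (auto intro!: derivative_eq_intros)
      thus "\<exists>y. ((\<lambda>a. a * cosh a - sinh a) has_real_derivative y) (at x) \<and> 0 \<le> y"
        using \<open>0 \<le> x\<close> by auto
    qed
    thus ?thesis by simp
  qed
  show ?thesis using pos[of a] pos[of "- a"] by (cases "a \<ge> 0") (auto simp: abs_if)
qed

text \<open>Exponential tilting: reweighting the sign by \<open>a\<close> moves its mean from
  \<open>x\<close> to some \<open>y\<close>, and the increment \<open>b\<close> sees a sign with
  mean \<open>y\<close>. The mean moves by at most \<open>2 * \<bar>a\<bar>\<close>, which gives the
  mixed term; Hoeffding's lemma at \<open>y\<close> gives \<open>b\<^sup>2 / 2\<close>.\<close>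

lemma two_point_mgf_add_le:
  assumes "\<bar>x\<bar> \<le> 1"
  shows "two_point_mgf x (a + b) \<le> two_point_mgf x a * exp (2 * \<bar>a * b\<bar> + b\<^sup>2 / 2)"
proof -
  define D where "D = cosh a + x * sinh a"
  define y where "y = (sinh a + x * cosh a) / D"
  have D: "D > 0" unfolding D_def by (rule cosh_sinh_comb_pos[OF assms])
  have x2: "x\<^sup>2 \<le> 1" using assms by (simp add: abs_square_le_1)
  have "\<bar>sinh a + x * cosh a\<bar> \<le> D"
  proof (rule abs_leI)
    have "0 \<le> (1 - x) * exp (- a)" "0 \<le> (1 + x) * exp a" using assms by auto
    hence "0 \<le> (1 - x) * (cosh a - sinh a)" "0 \<le> (1 + x) * (cosh a + sinh a)"
      by (simp_all add: cosh_minus_sinh cosh_plus_sinh)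
    thus "sinh a + x * cosh a \<le> D" "- (sinh a + x * cosh a) \<le> D"
      by (simp_all add: D_def algebra_simps)
  qed
  hence y: "\<bar>y\<bar> \<le> 1" using D by (simp add: y_def field_simps abs_le_iff)
  have yx: "y - x = (1 - x\<^sup>2) * sinh a / D"
    using D by (simp add: y_def field_simps D_def power2_eq_square)
  \<comment> \<open>A small \<open>D\<close> does no harm: in
    \<open>1 - x\<^sup>2 = (1 + \<bar>x\<bar>) * (1 - \<bar>x\<bar>)\<close> the second factor times
    \<open>cosh a\<close> is at most \<open>D\<close>.\<close>
  have "(1 - x\<^sup>2) * \<bar>sinh a\<bar> \<le> 2 * \<bar>a\<bar> * D"
  proof -
    have "(1 - x\<^sup>2) * \<bar>sinh a\<bar> \<le> (1 - x\<^sup>2) * (\<bar>a\<bar> * cosh a)"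
      using x2 by (intro mult_left_mono abs_sinh_le) auto
    also have "\<dots> = (1 + \<bar>x\<bar>) * (\<bar>a\<bar> * ((1 - \<bar>x\<bar>) * cosh a))"
      by (simp add: algebra_simps power2_eq_square)
    also have "\<dots> \<le> 2 * (\<bar>a\<bar> * D)"
    proof (intro mult_mono mult_left_mono)
      have "\<bar>sinh a\<bar> \<le> cosh a"
        using sinh_le_cosh_real[of a] sinh_le_cosh_real[of "- a"] by (simp add: abs_le_iff)
      hence "\<bar>x\<bar> * \<bar>sinh a\<bar> \<le> \<bar>x\<bar> * cosh a" by (intro mult_left_mono) auto
      moreover have "- (x * sinh a) \<le> \<bar>x\<bar> * \<bar>sinh a\<bar>" by (metis abs_ge_minus_self abs_mult)
      ultimately show "(1 - \<bar>x\<bar>) * cosh a \<le> D" unfolding D_def by (simp add: algebra_simps)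
    qed (use assms in auto)
    finally show ?thesis by simp
  qed
  hence yx': "\<bar>y - x\<bar> \<le> 2 * \<bar>a\<bar>"
    unfolding yx using D x2 by (simp add: abs_mult pos_divide_le_eq)
  have "cosh (a + b) + x * sinh (a + b) = D * (cosh b + y * sinh b)"
    using D unfolding y_def by (simp add: cosh_add sinh_add D_def field_simps)
  hence "two_point_mgf x (a + b) = two_point_mgf x a * (exp ((y - x) * b) * two_point_mgf y b)"
    by (simp add: two_point_mgf_def D_def[symmetric] algebra_simps flip: exp_add)
  also have "\<dots> \<le> two_point_mgf x a * (exp (2 * \<bar>a * b\<bar>) * exp (b\<^sup>2 / 2))"
  proof (intro mult_left_mono mult_mono)
    have "(y - x) * b \<le> \<bar>y - x\<bar> * \<bar>b\<bar>" by (metis abs_ge_self abs_mult)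
    also have "\<dots> \<le> 2 * \<bar>a\<bar> * \<bar>b\<bar>" using yx' by (intro mult_right_mono) auto
    finally show "exp ((y - x) * b) \<le> exp (2 * \<bar>a * b\<bar>)" by (simp add: abs_mult)
  qed (use y assms in \<open>auto intro!: two_point_mgf_le less_imp_le[OF two_point_mgf_pos]\<close>)
  finally show ?thesis by (simp add: exp_add)
qed

section \<open>Steps in the cube, semidefinite forms and residual directions\<close>

lemma ex_step_to_cube_boundary:
  fixes x u :: "'a \<Rightarrow> real"
  assumes "finite A" "p \<in> A" "u p \<noteq> 0" "\<And>i. i \<in> A \<Longrightarrow> \<bar>x i\<bar> < 1"
  obtains t where "t > 0" "\<And>i. i \<in> A \<Longrightarrow> \<bar>x i + t * u i\<bar> \<le> 1" "\<exists>i\<in>A. \<bar>x i + t * u i\<bar> = 1"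
proof -
  \<comment> \<open>Time at which coordinate \<open>i\<close> reaches the face of the cube it moves
    towards.\<close>
  define f where "f i = (1 - sgn (u i) * x i) / \<bar>u i\<bar>" for i
  define B where "B = {i \<in> A. u i \<noteq> 0}"
  define t where "t = Min (f ` B)"
  have B: "finite B" "B \<noteq> {}" using assms by (auto simp: B_def)
  have fpos: "f i > 0" if "i \<in> B" for i
    using that assms(4)[of i] by (auto simp: f_def B_def sgn_if abs_less_iff intro!: divide_pos_pos)
  have "t \<in> f ` B" unfolding t_def using B by (intro Min_in) auto
  then obtain i0 where i0: "i0 \<in> B" "t = f i0" by auto
  have tle: "t \<le> f i" if "i \<in> B" for i unfolding t_def using B that by auto
  have t: "t > 0" using i0 fpos by auto
  have eq: "\<bar>x i0 + t * u i0\<bar> = 1"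
    using i0 assms(4)[of i0] unfolding f_def B_def
    by (auto simp: sgn_if abs_if field_simps split: if_splits)
  have le: "\<bar>x i + t * u i\<bar> \<le> 1" if i: "i \<in> A" for i
  proof (cases "u i = 0")
    case True thus ?thesis using assms(4)[OF i] by simp
  next
    case False
    hence "t \<le> f i" using tle i by (auto simp: B_def)
    hence 1: "t * \<bar>u i\<bar> \<le> 1 - sgn (u i) * x i" using False by (simp add: f_def field_simps)
    have 2: "t * \<bar>u i\<bar> \<ge> 0" using t by simp
    show ?thesis using 1 2 assms(4)[OF i] False
      by (auto simp: sgn_if abs_if split: if_splits)
  qed
  show ?thesis using that[OF t le] eq i0 by (auto simp: B_def)
qed

text \<open>Only the Gram matrix of the vectors enters, never the vectors themselves, so a kernel
  can be used without a feature space. The form may be degenerate.\<close>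

locale gram =
  fixes S :: "'a set" and G :: "'a \<Rightarrow> 'a \<Rightarrow> real"
  assumes finite_S: "finite S"
    and G_sym: "\<And>i j. i \<in> S \<Longrightarrow> j \<in> S \<Longrightarrow> G i j = G j i"
    and G_psd: "\<And>x. 0 \<le> (\<Sum>i\<in>S. \<Sum>j\<in>S. x i * x j * G i j)"
begin

definition form :: "('a \<Rightarrow> real) \<Rightarrow> ('a \<Rightarrow> real) \<Rightarrow> real" where
  "form x y = (\<Sum>i\<in>S. \<Sum>j\<in>S. x i * y j * G i j)"

definition pair :: "('a \<Rightarrow> real) \<Rightarrow> ('a \<Rightarrow> real) \<Rightarrow> real" where
  "pair a x = (\<Sum>i\<in>S. a i * x i)"

definition unitv :: "'a \<Rightarrow> 'a \<Rightarrow> real" where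
  "unitv i = (\<lambda>j. if j = i then 1 else 0)"

lemma form_sym: "form x y = form y x"
proof -
  have "form x y = (\<Sum>j\<in>S. \<Sum>i\<in>S. x i * y j * G i j)"
    unfolding form_def by (rule sum.swap)
  also have "\<dots> = form y x" unfolding form_def
    by (intro sum.cong refl) (simp add: G_sym mult_ac)
  finally show ?thesis .
qed

lemma form_nonneg: "0 \<le> form x x"
  using G_psd[of x] by (simp add: form_def)

lemma form_add_left: "form (\<lambda>i. x i + t * y i) z = form x z + t * form y z"
  by (simp add: form_def sum.distrib sum_distrib_left algebra_simps)

lemma form_add_right: "form z (\<lambda>i. x i + t * y i) = form z x + t * form z y"
  using form_add_left by (metis form_sym)

lemma pair_add: "pair a (\<lambda>i. x i + t * y i) = pair a x + t * pair a y"
  by (simp add: pair_def sum.distrib sum_distrib_left algebra_simps)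

lemma form_unitv_right: "i \<in> S \<Longrightarrow> form x (unitv i) = (\<Sum>j\<in>S. x j * G j i)"
  using finite_S by (simp add: form_def unitv_def if_distrib if_distribR cong: if_cong)

lemma form_eq_sum: "form x y = (\<Sum>i\<in>S. y i * form x (unitv i))"
proof -
  have "form x y = (\<Sum>i\<in>S. \<Sum>j\<in>S. x j * y i * G j i)"
    unfolding form_def by (rule sum.swap)
  also have "\<dots> = (\<Sum>i\<in>S. y i * form x (unitv i))"
    by (intro sum.cong refl) (simp add: form_unitv_right sum_distrib_left mult_ac)
  finally show ?thesis .
qed

lemma form_eq_0:
  assumes "\<And>i. i \<in> V \<Longrightarrow> form x (unitv i) = 0" "\<And>i. i \<notin> V \<Longrightarrow> y i = 0"
  shows "form x y = 0"
  unfolding form_eq_sum[of x y] by (rule sum.neutral) (metis assms mult_eq_0_iff)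

lemma form_unitv_unitv: "i \<in> S \<Longrightarrow> form (unitv i) (unitv i) = G i i"
  using finite_S by (simp add: form_unitv_right) (simp add: unitv_def if_distrib if_distribR cong: if_cong)

lemma form_add_add:
  "form (\<lambda>i. x i + t * y i) (\<lambda>i. x i + t * y i) = form x x + 2 * t * form x y + t\<^sup>2 * form y y"
  by (simp add: form_add_left form_add_right form_sym[of y x] algebra_simps power2_eq_square)

text \<open>Otherwise \<open>form\<close> would be affine and unbounded below along the line through
  \<open>x\<close> in direction \<open>y\<close>; \<open>t\<close> is where it equals
  \<open>-1\<close>.\<close>

lemma form_eq_0_of_null:
  assumes "form y y = 0" shows "form x y = 0"
proof (rule ccontr)
  assume ne: "form x y \<noteq> 0"
  define t where "t = - (form x x + 1) / (2 * form x y)"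
  have "0 \<le> form (\<lambda>i. x i + t * y i) (\<lambda>i. x i + t * y i)" by (rule form_nonneg)
  also have "\<dots> = -1" unfolding form_add_add assms using ne by (simp add: t_def field_simps)
  finally show False by simp
qed

text \<open>Step direction of the walk: the coefficients of the pivot vector minus its orthogonal
  projection onto the span of \<open>V\<close>. Thus \<open>form u u\<close> is the squared distance
  of the pivot from that span.\<close>

definition residual :: "'a set \<Rightarrow> 'a \<Rightarrow> ('a \<Rightarrow> real) \<Rightarrow> bool" where
  "residual V p u \<longleftrightarrow> (\<forall>i. i \<notin> insert p V \<longrightarrow> u i = 0) \<and> u p = 1 \<and> (\<forall>i\<in>V. form u (unitv i) = 0)"

text \<open>Gram-Schmidt: the residual of \<open>p\<close> over \<open>V\<close> is corrected by a
  multiple of the residual of \<open>j\<close> over \<open>V\<close>.\<close>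

lemma residual_exists:
  assumes "finite V" "p \<notin> V"
  shows "\<exists>u. residual V p u"
  using assms
proof (induction V arbitrary: p rule: finite_induct)
  case empty
  show ?case by (intro exI[of _ "unitv p"]) (auto simp: residual_def unitv_def)
next
  case (insert j V)
  obtain u where u: "residual V p u" using insert by auto
  obtain w where w: "residual V j w" using insert by auto
  \<comment> \<open>\<open>w\<close> and \<open>unitv j\<close> differ by a vector supported on
    \<open>V\<close>, so orthogonality to \<open>w\<close> can replace orthogonality to
    \<open>unitv j\<close>.\<close>
  have form_j: "form y (unitv j) = form y w" if y: "\<And>i. i \<in> V \<Longrightarrow> form y (unitv i) = 0" for y
  proof -
    have "form y (\<lambda>i. w i + (-1) * unitv j i) = 0"
      using w insert.hyps by (intro form_eq_0[of V, OF y]) (auto simp: residual_def unitv_def)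
    thus ?thesis unfolding form_add_right by simp
  qed
  define t where "t = (if form w w = 0 then 0 else - form u w / form w w)"
  define y where "y = (\<lambda>i. u i + t * w i)"
  have y0: "form y (unitv i) = 0" if "i \<in> V" for i
    using that u w unfolding y_def form_add_left by (auto simp: residual_def)
  have "form y w = 0"
    unfolding y_def form_add_left using form_eq_0_of_null[of w u] by (auto simp: t_def)
  hence "form y (unitv j) = 0" using form_j[OF y0] by simp
  moreover have "y p = 1" using u w insert.prems by (auto simp: y_def residual_def)
  moreover have "y i = 0" if "i \<notin> insert p (insert j V)" for i
    using that u w by (auto simp: y_def residual_def)
  ultimately show ?case using y0 by (intro exI[of _ y]) (auto simp: residual_def)
qed

text \<open>The squared dual norm of \<open>a\<close> on the vectors supported on \<open>V\<close>: if \<open>G\<close> is the Gram matrix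
  of \<open>(w i)\<close> and \<open>a i = \<langle>\<theta>, w i\<rangle>\<close>, this is the squared norm of the orthogonal projection of
  \<open>\<theta>\<close> onto the span of \<open>w ` V\<close>.\<close>

definition dual :: "'a set \<Rightarrow> ('a \<Rightarrow> real) \<Rightarrow> real" where
  "dual V a = (SUP x\<in>{x. \<forall>i. i \<notin> V \<longrightarrow> x i = 0}. 2 * pair a x - form x x)"

text \<open>Makes the supremum in \<open>dual\<close> genuine for every \<open>V\<close>, and forces
  \<open>a\<close> to vanish on null vectors of the form.\<close>

definition dual_bounded :: "('a \<Rightarrow> real) \<Rightarrow> bool" where
  "dual_bounded a \<longleftrightarrow> (\<exists>M. \<forall>x. 2 * pair a x - form x x \<le> M)"

lemma dual_ge:
  assumes "dual_bounded a" "\<And>i. i \<notin> V \<Longrightarrow> x i = 0"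
  shows "2 * pair a x - form x x \<le> dual V a"
  unfolding dual_def using assms
  by (intro cSUP_upper) (auto simp: dual_bounded_def bdd_above_def)

lemma dual_le:
  assumes "\<And>x. (\<And>i. i \<notin> V \<Longrightarrow> x i = 0) \<Longrightarrow> 2 * pair a x - form x x \<le> M"
  shows "dual V a \<le> M"
  unfolding dual_def using assms by (intro cSUP_least) auto

lemma dual_nonneg: "dual_bounded a \<Longrightarrow> 0 \<le> dual V a"
  using dual_ge[of a V "\<lambda>_. 0"] by (simp add: pair_def form_def)

text \<open>Pythagoras: adding \<open>t * y\<close> to a competitor on \<open>V'\<close> creates no
  cross term, so passing from \<open>V\<close> to \<open>V'\<close> costs at least the maximum over
  \<open>t\<close> of a quadratic. The product form of the bound includes null
  \<open>y\<close>.\<close>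

lemma dual_orthogonal_gain:
  assumes a: "dual_bounded a" and "V' \<subseteq> V" and y: "\<And>i. i \<notin> V \<Longrightarrow> y i = 0"
    and orth: "\<And>i. i \<in> V' \<Longrightarrow> form y (unitv i) = 0"
  shows "dual V' a \<le> dual V a" and "(pair a y)\<^sup>2 \<le> form y y * (dual V a - dual V' a)"
proof -
  have gain: "dual V' a \<le> dual V a - (2 * t * pair a y - t\<^sup>2 * form y y)" for t
  proof (rule dual_le)
    fix x :: "'a \<Rightarrow> real" assume x: "\<And>i. i \<notin> V' \<Longrightarrow> x i = 0"
    have xy: "form x y = 0"
      unfolding form_sym[of x y] by (rule form_eq_0[of V']) (use orth x in auto)
    have "2 * pair a (\<lambda>i. x i + t * y i) - form (\<lambda>i. x i + t * y i) (\<lambda>i. x i + t * y i) \<le> dual V a"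
      by (rule dual_ge[OF a]) (use x y \<open>V' \<subseteq> V\<close> in auto)
    thus "2 * pair a x - form x x \<le> dual V a - (2 * t * pair a y - t\<^sup>2 * form y y)"
      unfolding pair_add form_add_add xy by (simp add: algebra_simps)
  qed
  show "dual V' a \<le> dual V a" using gain[of 0] by simp
  show "(pair a y)\<^sup>2 \<le> form y y * (dual V a - dual V' a)"
  proof (cases "form y y = 0")
    case True
    have "pair a y = 0"
    proof (rule ccontr)
      assume "pair a y \<noteq> 0"
      \<comment> \<open>At this \<open>t\<close> the gain would exceed the difference of the two
        duals.\<close>
      hence "2 * ((dual V a - dual V' a + 1) / (2 * pair a y)) * pair a y = dual V a - dual V' a + 1"
        by simp
      thus False using gain[of "(dual V a - dual V' a + 1) / (2 * pair a y)"] True by simp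
    qed
    thus ?thesis using True by simp
  next
    case False
    hence pos: "form y y > 0" using form_nonneg[of y] by simp
    have "(pair a y)\<^sup>2 / form y y \<le> dual V a - dual V' a"
      using gain[of "pair a y / form y y"] False by (simp add: power2_eq_square)
    thus ?thesis using pos by (simp add: field_simps)
  qed
qed

text \<open>Freezing coordinates with the pivot kept: the change \<open>y\<close> of the residual
  fits \<open>dual_orthogonal_gain\<close>, and \<open>u\<close> is orthogonal to \<open>y\<close>,
  so squared lengths subtract.\<close>

lemma residual_diff_form:
  assumes u: "residual V p u" and u': "residual V' p u'" and "V' \<subseteq> V" "p \<notin> V"
  defines "y \<equiv> (\<lambda>i. u' i + (-1) * u i)"
  shows "\<And>i. i \<notin> V \<Longrightarrow> y i = 0" "\<And>i. i \<in> V' \<Longrightarrow> form y (unitv i) = 0"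
    "form y y = form u' u' - form u u"
proof -
  show y: "y i = 0" if "i \<notin> V" for i
    using that u u' \<open>V' \<subseteq> V\<close> by (cases "i = p") (auto simp: y_def residual_def)
  show "form y (unitv i) = 0" if "i \<in> V'" for i
    using that u u' \<open>V' \<subseteq> V\<close> unfolding y_def form_add_left by (auto simp: residual_def)
  have "form u y = 0" by (rule form_eq_0[of V]) (use u y in \<open>auto simp: residual_def\<close>)
  hence "form u u' = form u u" unfolding y_def form_add_right by simp
  thus "form y y = form u' u' - form u u"
    unfolding y_def form_add_add form_sym[of u' u] by simp
qed

lemma residual_form_le:
  assumes u: "residual V p u" and "p \<notin> V" "p \<in> S"
  shows "form u u \<le> G p p"
proof -
  have "residual {} p (unitv p)" by (auto simp: residual_def unitv_def)
  from residual_diff_form(3)[OF u this _ \<open>p \<notin> V\<close>]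
  have "form u u \<le> form (unitv p) (unitv p)"
    using form_nonneg[of "\<lambda>i. unitv p i + (-1) * u i"] by simp
  thus ?thesis by (simp add: form_unitv_unitv[OF \<open>p \<in> S\<close>])
qed

end

section \<open>The potential and its evolution along the walk\<close>

locale unit_gram = gram +
  assumes G_diag: "\<And>i. i \<in> S \<Longrightarrow> G i i \<le> 1"
begin

text \<open>Bounds the conditional moment generating function \<open>E exp \<langle>a, \<sigma> - x\<rangle>\<close> of the final signs when
  the walk stands at a point with pivot coordinate \<open>x\<close>, residual direction \<open>u\<close> and free
  coordinates \<open>insert p V\<close>. The factor \<open>exp ((1 - form u u) * (pair a u)\<^sup>2)\<close> pays for the later growth
  of the residual, which happens when coordinates other than the pivot are frozen.\<close>

definition pot :: "'a set \<Rightarrow> ('a \<Rightarrow> real) \<Rightarrow> real \<Rightarrow> ('a \<Rightarrow> real) \<Rightarrow> real" where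
  "pot V u x a = exp (6 * dual V a) *
     (exp ((1 - form u u) * (pair a u)\<^sup>2) * two_point_mgf x (pair a u))"

text \<open>Taking \<open>p\<close> out of the free set lowers \<open>dual\<close> by \<Delta>, and
  \<open>b\<^sup>2 \<le> \<Delta>\<close>. The two new factors cost at most
  \<open>3 / 2 * b\<^sup>2\<close>, within the budget \<open>6 * \<Delta>\<close>.\<close>

lemma pot_new_pivot:
  assumes a: "dual_bounded a" and u: "residual V p u" and "p \<notin> V" "p \<in> S" "\<bar>x\<bar> \<le> 1"
  shows "pot V u x a \<le> exp (6 * dual (insert p V) a)"
proof -
  define s where "s = form u u"
  define b where "b = pair a u"
  define \<Delta> where "\<Delta> = dual (insert p V) a - dual V a"
  have s: "0 \<le> s" "s \<le> 1" using form_nonneg residual_form_le[OF u] assms G_diag[of p]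
    by (force simp: s_def)+
  have 1: "dual V a \<le> dual (insert p V) a" and 2: "b\<^sup>2 \<le> s * \<Delta>"
    using dual_orthogonal_gain[OF a, of V "insert p V" u] u
    by (auto simp: residual_def s_def b_def \<Delta>_def)
  have "s * \<Delta> \<le> 1 * \<Delta>" using s 1 by (intro mult_right_mono) (auto simp: \<Delta>_def)
  hence b: "b\<^sup>2 \<le> \<Delta>" using 2 by simp
  have "exp ((1 - s) * b\<^sup>2) * two_point_mgf x b \<le> exp (1 * b\<^sup>2) * exp (b\<^sup>2 / 2)"
    using s \<open>\<bar>x\<bar> \<le> 1\<close> by (intro mult_mono two_point_mgf_le exp_mono mult_right_mono)
      (auto intro: less_imp_le[OF two_point_mgf_pos])
  also have "\<dots> \<le> exp (6 * \<Delta>)" using b by (simp flip: exp_add) (use zero_le_power2[of b] in linarith)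
  finally have "pot V u x a \<le> exp (6 * dual V a) * exp (6 * \<Delta>)"
    unfolding pot_def by (intro mult_left_mono) (auto simp: s_def b_def)
  thus ?thesis by (simp add: \<Delta>_def algebra_simps flip: exp_add)
qed

text \<open>The pairing shifts by \<open>b\<close> with
  \<open>b\<^sup>2 \<le> \<tau> * \<Delta>\<close>, where \<tau> is the growth of the residual.
  Tilting and expanding the square cost
  \<open>4 * \<bar>\<alpha> * b\<bar> + 3 / 2 * b\<^sup>2\<close>. The factor
  \<open>1 - form u u\<close> releases \<open>\<tau> * \<alpha>\<^sup>2\<close> and
  \<open>dual\<close> releases \<open>6 * \<Delta>\<close>, enough because
  \<open>4 + 3 / 2 \<le> 6\<close>.\<close>

lemma pot_freeze:
  assumes a: "dual_bounded a" and u: "residual V p u" and u': "residual V' p u'"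
    and "V' \<subseteq> V" "p \<notin> V" "p \<in> S" "\<bar>x\<bar> \<le> 1"
  shows "pot V' u' x a \<le> pot V u x a"
proof -
  define s s' where "s = form u u" and "s' = form u' u'"
  define y where "y = (\<lambda>i. u' i + (-1) * u i)"
  define \<alpha> b where "\<alpha> = pair a u" and "b = pair a y"
  define \<Delta> where "\<Delta> = dual V a - dual V' a"
  have y: "\<And>i. i \<notin> V \<Longrightarrow> y i = 0" "\<And>i. i \<in> V' \<Longrightarrow> form y (unitv i) = 0" "form y y = s' - s"
    using residual_diff_form[OF u u' \<open>V' \<subseteq> V\<close> \<open>p \<notin> V\<close>] unfolding y_def s_def s'_def by blast+
  have gain: "dual V' a \<le> dual V a" "b\<^sup>2 \<le> (s' - s) * \<Delta>"
    using dual_orthogonal_gain[OF a \<open>V' \<subseteq> V\<close> y(1,2)] y(3) by (auto simp: b_def \<Delta>_def)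
  have pair_u': "pair a u' = \<alpha> + b"
    unfolding b_def y_def pair_add \<alpha>_def by simp
  have s: "0 \<le> s" "s \<le> s'" "s' \<le> 1"
    using form_nonneg[of u] form_nonneg[of y] y(3) residual_form_le[OF u'] assms G_diag[of p]
    by (force simp: s_def s'_def)+
  have \<Delta>: "\<Delta> \<ge> 0" using gain by (simp add: \<Delta>_def)
  define \<tau> where "\<tau> = s' - s"
  have \<tau>: "0 \<le> \<tau>" "\<tau> \<le> 1" using s by (auto simp: \<tau>_def)
  have "\<tau> * \<Delta> \<le> 1 * \<Delta>" using \<tau> \<Delta> by (intro mult_right_mono) auto
  hence b\<Delta>: "b\<^sup>2 \<le> \<Delta>" using gain(2) by (simp add: \<tau>_def)
  \<comment> \<open>Arithmetic-geometric mean inequality for the two summands on the right.\<close>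
  have ab: "4 * \<bar>\<alpha> * b\<bar> \<le> \<tau> * \<alpha>\<^sup>2 + 4 * \<Delta>"
  proof (rule power2_le_imp_le)
    have "(4 * \<bar>\<alpha> * b\<bar>)\<^sup>2 = 16 * \<alpha>\<^sup>2 * b\<^sup>2" by (simp add: power_mult_distrib)
    also have "\<dots> \<le> 16 * \<alpha>\<^sup>2 * (\<tau> * \<Delta>)" using gain(2) by (intro mult_left_mono) (auto simp: \<tau>_def)
    also have "\<dots> = 4 * (\<tau> * \<alpha>\<^sup>2) * (4 * \<Delta>)" by simp
    also have "\<dots> \<le> (\<tau> * \<alpha>\<^sup>2 + 4 * \<Delta>)\<^sup>2"
      using zero_le_power2[of "\<tau> * \<alpha>\<^sup>2 - 4 * \<Delta>"] by (simp add: power2_eq_square algebra_simps)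
    finally show "(4 * \<bar>\<alpha> * b\<bar>)\<^sup>2 \<le> (\<tau> * \<alpha>\<^sup>2 + 4 * \<Delta>)\<^sup>2" .
  qed (use \<tau> \<Delta> in auto)
  have "(1 - s') * (2 * (\<alpha> * b) + b\<^sup>2) \<le> 2 * \<bar>\<alpha> * b\<bar> + b\<^sup>2"
  proof -
    have "(1 - s') * (2 * (\<alpha> * b) + b\<^sup>2) \<le> (1 - s') * (2 * \<bar>\<alpha> * b\<bar> + b\<^sup>2)"
      using s by (intro mult_left_mono) auto
    also have "\<dots> \<le> 1 * (2 * \<bar>\<alpha> * b\<bar> + b\<^sup>2)" using s by (intro mult_right_mono) auto
    finally show ?thesis by simp
  qed
  moreover have "(1 - s') * (\<alpha> + b)\<^sup>2 = (1 - s) * \<alpha>\<^sup>2 - \<tau> * \<alpha>\<^sup>2 + (1 - s') * (2 * (\<alpha> * b) + b\<^sup>2)"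
    by (simp add: \<tau>_def power2_eq_square algebra_simps)
  ultimately have "(1 - s') * (\<alpha> + b)\<^sup>2 \<le> (1 - s) * \<alpha>\<^sup>2 - \<tau> * \<alpha>\<^sup>2 + 2 * \<bar>\<alpha> * b\<bar> + b\<^sup>2"
    by simp
  moreover have "6 * dual V' a = 6 * dual V a - 6 * \<Delta>" by (simp add: \<Delta>_def)
  ultimately have main: "6 * dual V' a + (1 - s') * (\<alpha> + b)\<^sup>2 + (2 * \<bar>\<alpha> * b\<bar> + b\<^sup>2 / 2) \<le>
      6 * dual V a + (1 - s) * \<alpha>\<^sup>2"
    using ab b\<Delta> \<Delta> by argo
  have "pot V' u' x a \<le> exp (6 * dual V' a) * (exp ((1 - s') * (\<alpha> + b)\<^sup>2) *
      (two_point_mgf x \<alpha> * exp (2 * \<bar>\<alpha> * b\<bar> + b\<^sup>2 / 2)))"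
    unfolding pot_def pair_u' s'_def
    by (intro mult_left_mono two_point_mgf_add_le[OF \<open>\<bar>x\<bar> \<le> 1\<close>]) auto
  also have "\<dots> = exp (6 * dual V' a + (1 - s') * (\<alpha> + b)\<^sup>2 + (2 * \<bar>\<alpha> * b\<bar> + b\<^sup>2 / 2)) * two_point_mgf x \<alpha>"
    by (simp add: exp_add)
  also have "\<dots> \<le> exp (6 * dual V a + (1 - s) * \<alpha>\<^sup>2) * two_point_mgf x \<alpha>"
    using main \<open>\<bar>x\<bar> \<le> 1\<close> by (intro mult_right_mono) (auto intro: less_imp_le[OF two_point_mgf_pos])
  also have "\<dots> = pot V u x a" by (simp add: pot_def s_def \<alpha>_def exp_add)
  finally show ?thesis .
qed

text \<open>Along the line \<open>x + t * u\<close> every summand of the potential is affine in \<open>t\<close>, so moving to one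
  of the two boundary points does not increase it.\<close>

lemma walk_step:
  assumes "finite A" "p \<in> A" "u p = 1" and x: "\<And>i. i \<in> A \<Longrightarrow> \<bar>x i\<bar> < 1"
  obtains t where "\<And>i. i \<in> A \<Longrightarrow> \<bar>x i + t * u i\<bar> \<le> 1" "\<exists>i\<in>A. \<bar>x i + t * u i\<bar> = 1"
    "(\<Sum>\<theta>\<in>\<Theta>. exp (pair (a \<theta>) (\<lambda>i. x i + t * u i)) * pot V u (x p + t) (a \<theta>)) \<le>
     (\<Sum>\<theta>\<in>\<Theta>. exp (pair (a \<theta>) x) * pot V u (x p) (a \<theta>))"
proof -
  obtain t1 where t1: "t1 > 0" "\<And>i. i \<in> A \<Longrightarrow> \<bar>x i + t1 * u i\<bar> \<le> 1" "\<exists>i\<in>A. \<bar>x i + t1 * u i\<bar> = 1"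
    using ex_step_to_cube_boundary[of A p u x] assms by auto
  obtain t2 where t2: "t2 > 0" "\<And>i. i \<in> A \<Longrightarrow> \<bar>x i + t2 * (- u i)\<bar> \<le> 1" "\<exists>i\<in>A. \<bar>x i + t2 * (- u i)\<bar> = 1"
    using ex_step_to_cube_boundary[of A p "\<lambda>i. - u i" x] assms by auto
  define w where "w \<theta> = exp (6 * dual V (a \<theta>)) * exp ((1 - form u u) * (pair (a \<theta>) u)\<^sup>2) *
    exp (pair (a \<theta>) x - x p * pair (a \<theta>) u)" for \<theta>
  \<comment> \<open>The exponential prefactor of \<open>two_point_mgf\<close> cancels the growth of
    \<open>exp (pair (a \<theta>) x)\<close> along the line, leaving \<open>cosh\<close> plus an
    affine multiple of \<open>sinh\<close>.\<close>
  have aff: "exp (pair (a \<theta>) (\<lambda>i. x i + t * u i)) * pot V u (x p + t) (a \<theta>) =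
      w \<theta> * (cosh (pair (a \<theta>) u) + x p * sinh (pair (a \<theta>) u)) + t * (w \<theta> * sinh (pair (a \<theta>) u))" for \<theta> t
  proof -
    have "exp (pair (a \<theta>) x - x p * pair (a \<theta>) u) =
        exp (pair (a \<theta>) (\<lambda>i. x i + t * u i)) * exp (- ((x p + t) * pair (a \<theta>) u))"
      unfolding pair_add by (simp add: algebra_simps flip: exp_add)
    thus ?thesis unfolding pot_def two_point_mgf_def w_def by (simp add: algebra_simps)
  qed
  define c0 c1 where "c0 = (\<Sum>\<theta>\<in>\<Theta>. w \<theta> * (cosh (pair (a \<theta>) u) + x p * sinh (pair (a \<theta>) u)))"
    and "c1 = (\<Sum>\<theta>\<in>\<Theta>. w \<theta> * sinh (pair (a \<theta>) u))"
  have tot: "(\<Sum>\<theta>\<in>\<Theta>. exp (pair (a \<theta>) (\<lambda>i. x i + t * u i)) * pot V u (x p + t) (a \<theta>)) = c0 + t * c1" for t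
    unfolding aff c0_def c1_def by (simp add: sum.distrib sum_distrib_left)
  have tot0: "(\<Sum>\<theta>\<in>\<Theta>. exp (pair (a \<theta>) x) * pot V u (x p) (a \<theta>)) = c0"
    using tot[of 0] by simp
  show ?thesis
  proof (cases "c1 \<le> 0")
    case True
    hence "t1 * c1 \<le> 0" using t1(1) by (simp add: mult_nonneg_nonpos)
    thus ?thesis using that[of t1] t1 tot tot0 by auto
  next
    case False
    hence "t2 * c1 \<ge> 0" using t2(1) by simp
    thus ?thesis using t2 tot[of "- t2"] tot0 by (intro that[of "- t2"]) auto
  qed
qed

text \<open>Strong induction on the number of free coordinates: each step freezes at least one, and
  the potential dominates the next stage whether the pivot survives, is replaced, or nothing is left
  free.\<close>

lemma walk:
  assumes a: "\<And>\<theta>. \<theta> \<in> \<Theta> \<Longrightarrow> dual_bounded (a \<theta>)"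
    and "A \<subseteq> S" "\<And>i. i \<in> A \<Longrightarrow> \<bar>x i\<bar> < 1" "\<And>i. i \<in> S - A \<Longrightarrow> \<bar>x i\<bar> = 1"
    and "p \<in> A" "residual (A - {p}) p u"
  shows "\<exists>\<sigma>. (\<forall>i\<in>S. \<bar>\<sigma> i\<bar> = 1) \<and>
    (\<Sum>\<theta>\<in>\<Theta>. exp (pair (a \<theta>) \<sigma>)) \<le> (\<Sum>\<theta>\<in>\<Theta>. exp (pair (a \<theta>) x) * pot (A - {p}) u (x p) (a \<theta>))"
  using assms(2-)
proof (induction "card A" arbitrary: A x p u rule: less_induct)
  case less
  have fin: "finite A" using less.prems finite_S finite_subset by blast
  have up: "u p = 1" and u0: "\<And>i. i \<notin> A \<Longrightarrow> u i = 0"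
    using less.prems(4,5) unfolding residual_def by (blast, metis insert_Diff)
  obtain t where t: "\<And>i. i \<in> A \<Longrightarrow> \<bar>x i + t * u i\<bar> \<le> 1" "\<exists>i\<in>A. \<bar>x i + t * u i\<bar> = 1"
    "(\<Sum>\<theta>\<in>\<Theta>. exp (pair (a \<theta>) (\<lambda>i. x i + t * u i)) * pot (A - {p}) u (x p + t) (a \<theta>)) \<le>
     (\<Sum>\<theta>\<in>\<Theta>. exp (pair (a \<theta>) x) * pot (A - {p}) u (x p) (a \<theta>))"
    using walk_step[where x = x and u = u and \<Theta> = \<Theta> and a = a and V = "A - {p}",
        OF fin less.prems(4) up less.prems(2)] by blast
  define x' where "x' = (\<lambda>i. x i + t * u i)"
  have x'p: "x' p = x p + t" by (simp add: x'_def up)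
  define A' where "A' = {i \<in> A. \<bar>x' i\<bar> < 1}"
  obtain i0 where "i0 \<in> A" "\<bar>x' i0\<bar> = 1" using t(2) by (auto simp: x'_def)
  hence "A' \<subset> A" unfolding A'_def by force
  hence card: "card A' < card A" using fin by (rule psubset_card_mono[rotated])
  have A': "A' \<subseteq> S" "A' \<subseteq> A" "finite A'" using less.prems fin by (auto simp: A'_def)
  have x'1: "\<bar>x' i\<bar> < 1" if "i \<in> A'" for i using that by (auto simp: A'_def)
  have x'2: "\<bar>x' i\<bar> = 1" if "i \<in> S - A'" for i
  proof (cases "i \<in> A")
    case True thus ?thesis using that t(1)[of i] by (auto simp: A'_def x'_def)
  next
    case False thus ?thesis using that less.prems(3)[of i] u0[of i] by (auto simp: x'_def)
  qed
  have pS: "p \<in> S" using less.prems by auto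
  \<comment> \<open>\<open>R\<close> is the bound for the remaining walk: a new \<open>pot\<close>,
    or \<open>1\<close> once everything is frozen.\<close>
  have suff: ?case
    if "\<exists>\<sigma>. (\<forall>i\<in>S. \<bar>\<sigma> i\<bar> = 1) \<and>
    (\<Sum>\<theta>\<in>\<Theta>. exp (pair (a \<theta>) \<sigma>)) \<le> (\<Sum>\<theta>\<in>\<Theta>. exp (pair (a \<theta>) x') * R \<theta>)"
    "\<And>\<theta>. \<theta> \<in> \<Theta> \<Longrightarrow> R \<theta> \<le> pot (A - {p}) u (x' p) (a \<theta>)" for R
  proof -
    have "(\<Sum>\<theta>\<in>\<Theta>. exp (pair (a \<theta>) x') * R \<theta>) \<le>
        (\<Sum>\<theta>\<in>\<Theta>. exp (pair (a \<theta>) x') * pot (A - {p}) u (x' p) (a \<theta>))"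
      using that(2) by (intro sum_mono mult_left_mono) auto
    also have "\<dots> \<le> (\<Sum>\<theta>\<in>\<Theta>. exp (pair (a \<theta>) x) * pot (A - {p}) u (x p) (a \<theta>))"
      unfolding x'p using t(3) by (simp add: x'_def)
    finally show ?thesis using that(1) order_trans by blast
  qed
  show ?case
  proof (cases "p \<in> A'")
    case True
    obtain u' where u': "residual (A' - {p}) p u'"
      using residual_exists[of "A' - {p}" p] A' by auto
    show ?thesis
    proof (rule suff[OF less.hyps[OF card A'(1) x'1 x'2 True u']])
      fix \<theta> assume "\<theta> \<in> \<Theta>"
      thus "pot (A' - {p}) u' (x' p) (a \<theta>) \<le> pot (A - {p}) u (x' p) (a \<theta>)"
        using a A' pS x'1[OF True] by (intro pot_freeze[OF _ less.prems(5) u']) auto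
    qed
  next
    case False
    have g1: "two_point_mgf (x' p) b = 1" for b
      using x'2[of p] False pS by (simp add: two_point_mgf_eq_1)
    have "form u u \<le> 1"
      using residual_form_le[OF less.prems(5) _ pS] G_diag[OF pS] by simp
    \<comment> \<open>A frozen pivot carries no randomness: its factors in \<open>pot\<close> are at
      least \<open>1\<close>, and the \<open>dual\<close> budget passes on to the next
      pivot.\<close>
    hence done_le: "exp (6 * dual A' (a \<theta>)) \<le> pot (A - {p}) u (x' p) (a \<theta>)" if "\<theta> \<in> \<Theta>" for \<theta>
    proof -
      have "dual A' (a \<theta>) \<le> dual (A - {p}) (a \<theta>)"
        using dual_orthogonal_gain(1)[OF a[OF that], of A' "A - {p}" "\<lambda>_. 0"] A' False
        by (auto simp: form_def)
      hence "exp (6 * dual A' (a \<theta>)) * 1 \<le> exp (6 * dual (A - {p}) (a \<theta>)) *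
          exp ((1 - form u u) * (pair (a \<theta>) u)\<^sup>2)"
        using \<open>form u u \<le> 1\<close> by (intro mult_mono) auto
      thus ?thesis by (simp add: pot_def g1)
    qed
    show ?thesis
    proof (cases "A' = {}")
      case True
      have "\<forall>i\<in>S. \<bar>x' i\<bar> = 1" using x'2 True by auto
      moreover have "1 \<le> pot (A - {p}) u (x' p) (a \<theta>)" if "\<theta> \<in> \<Theta>" for \<theta>
        using dual_nonneg[OF a[OF that], of A'] done_le[OF that] by (meson one_le_exp_iff order_trans
            zero_le_mult_iff zero_le_numeral)
      ultimately show ?thesis by (intro suff[of "\<lambda>_. 1"]) auto
    next
      case False
      then obtain p' where p': "p' \<in> A'" by auto
      obtain u' where u': "residual (A' - {p'}) p' u'"
        using residual_exists[of "A' - {p'}" p'] A' by auto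
      show ?thesis
      proof (rule suff[OF less.hyps[OF card A'(1) x'1 x'2 p' u']])
        fix \<theta> assume \<theta>: "\<theta> \<in> \<Theta>"
        have "pot (A' - {p'}) u' (x' p') (a \<theta>) \<le> exp (6 * dual (insert p' (A' - {p'})) (a \<theta>))"
          using A' p' x'1[OF p'] by (intro pot_new_pivot[OF a[OF \<theta>] u']) auto
        also have "insert p' (A' - {p'}) = A'" using p' by auto
        also note done_le[OF \<theta>]
        finally show "pot (A' - {p'}) u' (x' p') (a \<theta>) \<le> pot (A - {p}) u (x' p) (a \<theta>)" .
      qed
    qed
  qed
qed

text \<open>The walk starts at the origin with all coordinates free, where the potential is at most
  \<open>exp (6 * dual S (a \<theta>))\<close>; the hypothesis bounds this squared dual
  norm.\<close>

theorem subgaussian_signs: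
  assumes M: "\<And>\<theta> x. \<theta> \<in> \<Theta> \<Longrightarrow> 2 * pair (a \<theta>) x - form x x \<le> M \<theta>"
  shows "\<exists>\<sigma>. (\<forall>i\<in>S. \<bar>\<sigma> i\<bar> = 1) \<and> (\<Sum>\<theta>\<in>\<Theta>. exp (pair (a \<theta>) \<sigma>)) \<le> (\<Sum>\<theta>\<in>\<Theta>. exp (6 * M \<theta>))"
proof (cases "S = {}")
  case True
  have "0 \<le> M \<theta>" if "\<theta> \<in> \<Theta>" for \<theta> using M[OF that, of "\<lambda>_. 0"] by (simp add: pair_def form_def)
  hence "(\<Sum>\<theta>\<in>\<Theta>. 1) \<le> (\<Sum>\<theta>\<in>\<Theta>. exp (6 * M \<theta>))" by (intro sum_mono) auto
  thus ?thesis unfolding pair_def using True by auto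
next
  case False
  then obtain p where p: "p \<in> S" by auto
  obtain u where u: "residual (S - {p}) p u"
    using residual_exists[of "S - {p}" p] finite_S by auto
  have a: "dual_bounded (a \<theta>)" if "\<theta> \<in> \<Theta>" for \<theta>
    using M[OF that] by (auto simp: dual_bounded_def)
  obtain \<sigma> where \<sigma>: "\<forall>i\<in>S. \<bar>\<sigma> i\<bar> = 1"
    "(\<Sum>\<theta>\<in>\<Theta>. exp (pair (a \<theta>) \<sigma>)) \<le> (\<Sum>\<theta>\<in>\<Theta>. exp (pair (a \<theta>) (\<lambda>_. 0)) * pot (S - {p}) u 0 (a \<theta>))"
    using walk[where \<Theta> = \<Theta> and a = a and A = S and x = "\<lambda>_. 0" and p = p and u = u] a p u by auto
  have "exp (pair (a \<theta>) (\<lambda>_. 0)) * pot (S - {p}) u 0 (a \<theta>) \<le> exp (6 * M \<theta>)" if "\<theta> \<in> \<Theta>" for \<theta>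
  proof -
    have "pot (S - {p}) u 0 (a \<theta>) \<le> exp (6 * dual (insert p (S - {p})) (a \<theta>))"
      using p by (intro pot_new_pivot[OF a[OF that] u]) auto
    also have "\<dots> \<le> exp (6 * M \<theta>)" using M[OF that] by (auto intro!: dual_le)
    finally show ?thesis by (simp add: pair_def)
  qed
  thus ?thesis using \<sigma> by (meson order_trans sum_mono)
qed

end

subsection \<open>The exponential kernel\<close>

lemma vnorm_eq_L2_set: "vnorm d x = L2_set x {..<d}"
  by (simp add: vnorm_def dotp_def L2_set_def power2_eq_square)

lemma vnorm_nonneg: "0 \<le> vnorm d x"
  by (simp add: vnorm_eq_L2_set)

lemma vnorm_power2: "(vnorm d x)\<^sup>2 = dotp d x x"
  by (simp add: vnorm_def dotp_def sum_nonneg)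

lemma abs_dotp_le: "\<bar>dotp d x y\<bar> \<le> vnorm d x * vnorm d y"
proof -
  have "\<bar>dotp d x y\<bar> \<le> (\<Sum>j<d. \<bar>x j\<bar> * \<bar>y j\<bar>)"
    unfolding dotp_def using sum_abs[of "\<lambda>j. x j * y j" "{..<d}"] by (simp add: abs_mult)
  also have "\<dots> \<le> vnorm d x * vnorm d y"
    unfolding vnorm_eq_L2_set by (rule L2_set_mult_ineq)
  finally show ?thesis .
qed

lemma vnorm_triangle: "vnorm d (\<lambda>j. x j + y j) \<le> vnorm d x + vnorm d y"
  unfolding vnorm_eq_L2_set by (rule L2_set_triangle_ineq)

lemma vnorm_scale: "vnorm d (\<lambda>j. c * x j) = \<bar>c\<bar> * vnorm d x"
proof -
  have "dotp d (\<lambda>j. c * x j) (\<lambda>j. c * x j) = c\<^sup>2 * dotp d x x"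
    by (simp add: dotp_def sum_distrib_left power2_eq_square mult_ac)
  thus ?thesis by (simp add: vnorm_def real_sqrt_mult)
qed

lemma vnorm_sum_le: "finite I \<Longrightarrow> vnorm d (\<lambda>j. \<Sum>i\<in>I. f i j) \<le> (\<Sum>i\<in>I. vnorm d (f i))"
proof (induction I rule: finite_induct)
  case empty show ?case by (simp add: vnorm_def dotp_def)
next
  case (insert a I)
  thus ?case using vnorm_triangle[of d "f a" "\<lambda>j. \<Sum>i\<in>I. f i j"] by simp
qed

lemma vnorm_le_bound:
  assumes "\<And>j. j < d \<Longrightarrow> \<bar>x j\<bar> \<le> s" "s \<ge> 0"
  shows "vnorm d x \<le> s * sqrt (real d)"
proof -
  have "x j * x j \<le> s\<^sup>2" if "j < d" for j
    using assms(1)[OF that] assms(2) abs_le_square_iff[of "x j" s] by (simp add: power2_eq_square)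
  hence "vnorm d x \<le> sqrt (\<Sum>j<d. s\<^sup>2)"
    unfolding vnorm_def dotp_def by (intro real_sqrt_le_mono sum_mono) auto
  also have "\<dots> = s * sqrt (real d)" using assms by (simp add: real_sqrt_mult)
  finally show ?thesis .
qed

lemma vnorm_mono: "(\<And>j. j < d \<Longrightarrow> \<bar>x j\<bar> \<le> \<bar>y j\<bar>) \<Longrightarrow> vnorm d x \<le> vnorm d y"
  unfolding vnorm_def dotp_def power2_eq_square[symmetric]
  by (intro real_sqrt_le_mono sum_mono) (simp add: abs_le_square_iff)

lemma abs_le_vnorm: "j < d \<Longrightarrow> \<bar>x j\<bar> \<le> vnorm d x"
  using member_le_L2_set[of "{..<d}" j "\<lambda>j. \<bar>x j\<bar>"] by (simp add: vnorm_eq_L2_set L2_set_def)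

lemma sum_abs_le_vnorm: "(\<Sum>j<d. \<bar>x j\<bar>) \<le> sqrt (real d) * vnorm d x"
  using L2_set_mult_ineq[of "\<lambda>_. 1" x "{..<d}"] by (simp add: vnorm_eq_L2_set L2_set_constant)

lemma dotp_commute: "dotp d x y = dotp d y x"
  by (simp add: dotp_def mult.commute)

lemma dotp_diff_left: "dotp d (\<lambda>j. x j - y j) z = dotp d x z - dotp d y z"
  by (simp add: dotp_def sum_subtractf algebra_simps)

lemma dotp_scale_left: "dotp d (\<lambda>j. c * x j) z = c * dotp d x z"
  by (simp add: dotp_def sum_distrib_left mult_ac)

lemma dotp_scale_right: "dotp d x (\<lambda>j. c * z j) = c * dotp d x z"
  by (simp add: dotp_def sum_distrib_left mult_ac)

lemma dotp_sum_right: "dotp d z (\<lambda>j. \<Sum>i\<in>S. w i * v i j) = (\<Sum>i\<in>S. w i * dotp d z (v i))"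
proof -
  have "dotp d z (\<lambda>j. \<Sum>i\<in>S. w i * v i j) = (\<Sum>j<d. \<Sum>i\<in>S. w i * (z j * v i j))"
    by (simp add: dotp_def sum_distrib_left mult_ac)
  also have "\<dots> = (\<Sum>i\<in>S. w i * dotp d z (v i))"
    by (subst sum.swap) (simp add: dotp_def sum_distrib_left)
  finally show ?thesis .
qed

section \<open>Positive semidefinite kernels\<close>

lemma psd_mult_dotp:
  assumes "\<And>c :: 'a \<Rightarrow> real. 0 \<le> (\<Sum>i\<in>T. \<Sum>j\<in>T. c i * c j * K i j)"
  shows "0 \<le> (\<Sum>i\<in>T. \<Sum>j\<in>T. c i * c j * (dotp d (f i) (f j) * K i j))"
proof -
  \<comment> \<open>Schur product theorem in coordinates: each \<open>l\<close> contributes the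
    quadratic form of \<open>K\<close> with coefficients \<open>c i * f i l\<close>.\<close>
  have "(\<Sum>i\<in>T. \<Sum>j\<in>T. c i * c j * (dotp d (f i) (f j) * K i j)) =
      (\<Sum>i\<in>T. \<Sum>j\<in>T. \<Sum>l<d. (c i * f i l) * (c j * f j l) * K i j)"
    by (simp add: dotp_def sum_distrib_left sum_distrib_right mult_ac)
  also have "\<dots> = (\<Sum>i\<in>T. \<Sum>l<d. \<Sum>j\<in>T. (c i * f i l) * (c j * f j l) * K i j)"
    by (intro sum.cong refl sum.swap)
  also have "\<dots> = (\<Sum>l<d. \<Sum>i\<in>T. \<Sum>j\<in>T. (c i * f i l) * (c j * f j l) * K i j)"
    by (rule sum.swap)
  also have "\<dots> \<ge> 0" by (intro sum_nonneg assms)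
  finally show ?thesis .
qed

lemma psd_power_kernel:
  fixes c :: "'a \<Rightarrow> real"
  shows "0 \<le> (\<Sum>i\<in>T. \<Sum>j\<in>T. c i * c j * (dotp d (f i) (f j) ^ m * dotp e (u i) (u j)))"
proof (induction m arbitrary: c)
  case 0
  have "0 \<le> (\<Sum>i\<in>T. \<Sum>j\<in>T. c i * c j * (dotp e (u i) (u j) * 1))" for c :: "'a \<Rightarrow> real"
  proof (rule psd_mult_dotp)
    fix c :: "'a \<Rightarrow> real"
    have "(\<Sum>i\<in>T. \<Sum>j\<in>T. c i * c j * 1) = (\<Sum>i\<in>T. c i)\<^sup>2"
      by (simp add: power2_eq_square sum_product)
    thus "0 \<le> (\<Sum>i\<in>T. \<Sum>j\<in>T. c i * c j * 1)" by simp
  qed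
  thus ?case by simp
next
  case (Suc m)
  from psd_mult_dotp[OF Suc.IH, of c d f] show ?case by (simp add: mult_ac)
qed

text \<open>The exponential series has nonnegative coefficients, and each power of the scalar
  product is semidefinite by repeated Schur products.\<close>

lemma psd_exp_kernel:
  fixes c :: "'a \<Rightarrow> real"
  assumes "\<kappa> \<ge> 0"
  shows "0 \<le> (\<Sum>i\<in>T. \<Sum>j\<in>T. c i * c j * (exp (\<kappa> * dotp d (f i) (f j)) * dotp e (u i) (u j)))"
proof -
  have lim: "(\<lambda>m. \<Sum>i\<in>T. \<Sum>j\<in>T. c i * c j * ((\<kappa> * dotp d (f i) (f j)) ^ m /\<^sub>R fact m * dotp e (u i) (u j)))
     sums (\<Sum>i\<in>T. \<Sum>j\<in>T. c i * c j * (exp (\<kappa> * dotp d (f i) (f j)) * dotp e (u i) (u j)))"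
    by (intro sums_sum sums_mult sums_mult2 exp_converges)
  have nonneg: "0 \<le> (\<Sum>i\<in>T. \<Sum>j\<in>T. c i * c j * ((\<kappa> * dotp d (f i) (f j)) ^ m /\<^sub>R fact m * dotp e (u i) (u j)))" for m
  proof -
    have "(\<Sum>i\<in>T. \<Sum>j\<in>T. c i * c j * ((\<kappa> * dotp d (f i) (f j)) ^ m /\<^sub>R fact m * dotp e (u i) (u j))) =
      (\<kappa> ^ m / fact m) * (\<Sum>i\<in>T. \<Sum>j\<in>T. c i * c j * (dotp d (f i) (f j) ^ m * dotp e (u i) (u j)))"
      unfolding sum_distrib_left
      by (intro sum.cong refl) (simp add: power_mult_distrib divide_inverse mult_ac)
    also have "\<dots> \<ge> 0" using assms by (intro mult_nonneg_nonneg psd_power_kernel) auto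
    finally show ?thesis .
  qed
  show ?thesis by (rule sums_le[OF nonneg sums_zero lim])
qed

text \<open>Completes the square without a feature space: the query enters as one more point of the
  semidefinite kernel. The result is the dual norm bound that \<open>subgaussian_signs\<close> asks
  for.\<close>

lemma exp_kernel_dual_bound:
  fixes x :: "'a \<Rightarrow> real"
  assumes "finite S" "\<rho> > 0"
  shows "2 * (\<Sum>i\<in>S. l * (exp (dotp d y (k i)) * dotp e z (v i)) * x i) -
      (\<Sum>i\<in>S. \<Sum>j\<in>S. x i * x j * (exp (\<rho> * (dotp d (k i) (k j) - 1)) * dotp e (v i) (v j)))
    \<le> l\<^sup>2 * (exp (\<rho> + (vnorm d y)\<^sup>2 / \<rho>) * (vnorm e z)\<^sup>2)"
proof -
  \<comment> \<open>\<open>None\<close> is the query, placed at \<open>y / \<rho>\<close> so that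
    its kernel with a key is \<open>exp (dotp d y (k i))\<close>. Its coefficient makes the cross
    term \<open>- 2 * l * P\<close> after normalisation by \<open>exp (- \<rho>)\<close>.\<close>
  define f where "f = case_option (\<lambda>j. (1 / \<rho>) * y j) k"
  define u where "u = case_option z v"
  define c where "c = case_option (- (l * exp \<rho>)) x"
  define K where "K i j = exp (\<rho> * dotp d (f i) (f j)) * dotp e (u i) (u j)" for i j
  have K_sym: "K (Some i) None = K None (Some i)" for i by (simp add: K_def dotp_commute)
  define Q where "Q = (\<Sum>i\<in>S. \<Sum>j\<in>S. x i * x j * K (Some i) (Some j))"
  define P where "P = (\<Sum>i\<in>S. x i * K None (Some i))"
  have "0 \<le> (\<Sum>i\<in>insert None (Some ` S). \<Sum>j\<in>insert None (Some ` S). c i * c j * K i j)"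
    unfolding K_def using assms by (intro psd_exp_kernel) auto
  also have "\<dots> = c None * c None * K None None + (\<Sum>j\<in>S. c None * x j * K None (Some j)) +
      ((\<Sum>i\<in>S. x i * c None * K (Some i) None) + Q)"
    using assms by (simp add: sum.reindex inj_on_def sum.distrib sum_subtractf sum_negf Q_def c_def)
  also have "\<dots> = (c None)\<^sup>2 * K None None + 2 * c None * P + Q"
    unfolding P_def K_sym by (simp add: sum_distrib_left power2_eq_square mult_ac)
  finally have "0 \<le> exp (- \<rho>) * ((c None)\<^sup>2 * K None None + 2 * c None * P + Q)"
    by (intro mult_nonneg_nonneg) auto
  moreover have "exp (- \<rho>) * (2 * c None * P) = - 2 * l * P"
    by (simp add: c_def exp_minus field_simps)
  moreover have "exp (- \<rho>) * ((c None)\<^sup>2 * K None None) = l\<^sup>2 * (exp (\<rho> + (vnorm d y)\<^sup>2 / \<rho>) * (vnorm e z)\<^sup>2)"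
  proof -
    have "\<rho> * dotp d (f None) (f None) = (vnorm d y)\<^sup>2 / \<rho>"
      using assms unfolding f_def option.case dotp_scale_left dotp_scale_right vnorm_power2
      by (simp add: field_simps)
    moreover have "exp (- \<rho>) * (c None)\<^sup>2 = l\<^sup>2 * exp \<rho>"
      by (simp add: c_def power2_eq_square exp_minus field_simps)
    ultimately show ?thesis by (simp add: K_def u_def vnorm_power2 exp_add mult_ac)
  qed
  moreover have "exp (- \<rho>) * Q =
      (\<Sum>i\<in>S. \<Sum>j\<in>S. x i * x j * (exp (\<rho> * (dotp d (k i) (k j) - 1)) * dotp e (v i) (v j)))"
    unfolding Q_def sum_distrib_left
  proof (intro sum.cong refl)
    fix i j
    have "exp (\<rho> * (dotp d (k i) (k j) - 1)) = exp (- \<rho>) * exp (\<rho> * dotp d (k i) (k j))"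
      by (simp add: algebra_simps flip: exp_add)
    thus "exp (- \<rho>) * (x i * x j * K (Some i) (Some j)) =
        x i * x j * (exp (\<rho> * (dotp d (k i) (k j) - 1)) * dotp e (v i) (v j))"
      by (simp add: K_def f_def u_def mult_ac)
  qed
  moreover have "l * P = (\<Sum>i\<in>S. l * (exp (dotp d y (k i)) * dotp e z (v i)) * x i)"
  proof -
    have "\<rho> * dotp d (f None) (f (Some i)) = dotp d y (k i)" for i
      using assms unfolding f_def option.case dotp_scale_left by simp
    thus ?thesis unfolding P_def sum_distrib_left by (simp add: K_def u_def mult_ac)
  qed
  ultimately show ?thesis by (simp add: algebra_simps)
qed

locale exp_kernel =
  fixes S :: "'a set" and d e :: nat and \<rho> :: real and k v :: "'a \<Rightarrow> nat \<Rightarrow> real"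
  assumes finite_keys: "finite S" and \<rho>_pos: "\<rho> > 0"
    and k_le: "\<And>i. i \<in> S \<Longrightarrow> vnorm d (k i) \<le> 1"
    and v_le: "\<And>i. i \<in> S \<Longrightarrow> vnorm e (v i) \<le> 1"

text \<open>The normalisation by \<open>exp (- \<rho>)\<close> brings the diagonal down to at most
  \<open>1\<close> for keys and values in the unit ball.\<close>

sublocale exp_kernel \<subseteq> unit_gram S "\<lambda>i j. exp (\<rho> * (dotp d (k i) (k j) - 1)) * dotp e (v i) (v j)"
proof
  show "finite S" by (rule finite_keys)
  show "exp (\<rho> * (dotp d (k i) (k j) - 1)) * dotp e (v i) (v j) =
      exp (\<rho> * (dotp d (k j) (k i) - 1)) * dotp e (v j) (v i)" for i j
    by (simp add: dotp_commute)
  \<comment> \<open>At \<open>l = 0\<close> the dual bound is semidefiniteness itself.\<close>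
  show "0 \<le> (\<Sum>i\<in>S. \<Sum>j\<in>S. x i * x j * (exp (\<rho> * (dotp d (k i) (k j) - 1)) * dotp e (v i) (v j)))" for x
    using exp_kernel_dual_bound[of S \<rho> 0 d "\<lambda>_. 0" k e "\<lambda>_. 0" v x] finite_keys \<rho>_pos by simp
  show "exp (\<rho> * (dotp d (k i) (k i) - 1)) * dotp e (v i) (v i) \<le> 1" if "i \<in> S" for i
  proof -
    have "dotp d (k i) (k i) \<le> 1" "dotp e (v i) (v i) \<le> 1" "0 \<le> dotp e (v i) (v i)"
      using k_le[OF that] v_le[OF that] vnorm_nonneg by (auto simp flip: vnorm_power2 simp: power_le_one)
    thus ?thesis using \<rho>_pos by (intro mult_le_one) (auto simp: mult_nonneg_nonpos)
  qed
qed

subsection \<open>Discrepancy over a ball of queries\<close>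

lemma sum_int_sym_interval_Suc:
  fixes f :: "int \<Rightarrow> real"
  shows "(\<Sum>t\<in>{- int (Suc B)..int (Suc B)}. f t) =
    f (int (Suc B)) + f (- int (Suc B)) + (\<Sum>t\<in>{- int B..int B}. f t)"
proof -
  have "{- int (Suc B)..int (Suc B)} = insert (int (Suc B)) (insert (- int (Suc B)) {- int B..int B})"
    by auto
  thus ?thesis by simp
qed

text \<open>Opposite terms add up to at least \<open>2\<close>. This keeps the averaging factor
  \<open>h\<close> of the cube at least \<open>1\<close>, so values divided by it stay in the unit
  ball.\<close>

lemma sum_exp_sym_ge: "2 * real N + 1 \<le> (\<Sum>t\<in>{- int N..int N}. exp (c * real_of_int t))"
proof (induction N)
  case 0 show ?case by simp
next
  case (Suc N)
  have "1 + c * real (Suc N) \<le> exp (c * real (Suc N))"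
    "1 + - (c * real (Suc N)) \<le> exp (- (c * real (Suc N)))"
    by (rule exp_ge_add_one_self)+
  hence "2 \<le> exp (c * real (Suc N)) + exp (- (c * real (Suc N)))" by linarith
  moreover have "c * real_of_int (int (Suc N)) = c * real (Suc N)"
    "c * real_of_int (- int (Suc N)) = - (c * real (Suc N))" by (simp_all add: algebra_simps)
  ultimately have two: "2 \<le> exp (c * real_of_int (int (Suc N))) + exp (c * real_of_int (- int (Suc N)))"
    by (simp only:)
  have "2 * real (Suc N) + 1 = 2 + (2 * real N + 1)" by simp
  also note add_mono[OF two Suc.IH]
  finally show ?case unfolding sum_int_sym_interval_Suc .
qed

text \<open>Geometric series with ratio \<open>r\<close>; it is the total weight of one coordinate
  in the lattice count.\<close>

lemma sum_exp_abs_le: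
  assumes "A > 0"
  shows "(\<Sum>t\<in>{- int B..int B}. exp (- (\<bar>real_of_int t\<bar> / A))) \<le> 2 * (A + 1)"
proof -
  define r where "r = exp (- (1 / A))"
  have r: "r > 0" "r < 1" using assms by (auto simp: r_def)
  have "1 + 1 / A \<le> exp (1 / A)" by (rule exp_ge_add_one_self)
  hence "r * (1 + 1 / A) \<le> r * exp (1 / A)" using r by (intro mult_left_mono) auto
  also have "r * exp (1 / A) = 1" by (simp add: r_def flip: exp_add)
  finally have r_le: "1 / (1 - r) \<le> A + 1" using assms r by (simp add: field_simps)
  have "(\<Sum>t\<in>{- int B..int B}. exp (- (\<bar>real_of_int t\<bar> / A))) \<le> 2 * (1 - r ^ Suc B) / (1 - r)"
  proof (induction B)
    case 0 show ?case using r by (simp add: field_simps)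
  next
    case (Suc B)
    have "exp (- (real (Suc B) / A)) = r ^ Suc B"
      unfolding r_def exp_of_nat_mult[symmetric] by simp
    moreover have "2 * r ^ Suc B + 2 * (1 - r ^ Suc B) / (1 - r) = 2 * (1 - r ^ Suc (Suc B)) / (1 - r)"
      using r by (simp add: field_simps)
    moreover have "\<bar>real_of_int (int (Suc B))\<bar> = real (Suc B)" "\<bar>real_of_int (- int (Suc B))\<bar> = real (Suc B)"
      by simp_all
    ultimately show ?case using Suc.IH unfolding sum_int_sym_interval_Suc by (simp only:)
  qed
  also have "\<dots> \<le> 2 * (1 / (1 - r))"
    using r by (simp add: divide_right_mono)
  also have "\<dots> \<le> 2 * (A + 1)" using r_le by simp
  finally show ?thesis .
qed

text \<open>Extensional integer vectors represent each lattice point once; the box supplies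
  finiteness.\<close>

definition lattice_ball :: "nat \<Rightarrow> real \<Rightarrow> real \<Rightarrow> (nat \<Rightarrow> int) set" where
  "lattice_ball d s R = {m \<in> PiE {..<d} (\<lambda>_. {- int (nat \<lceil>R / s\<rceil>)..int (nat \<lceil>R / s\<rceil>)}).
     vnorm d (\<lambda>j. s * real_of_int (m j)) \<le> R}"

lemma finite_lattice_ball: "finite (lattice_ball d s R)"
  unfolding lattice_ball_def by (intro finite_Collect_conjI disjI1) (auto intro: finite_PiE)

lemma lattice_ballI:
  assumes "s > 0" "vnorm d (\<lambda>j. s * real_of_int (m j)) \<le> R"
  shows "restrict m {..<d} \<in> lattice_ball d s R"
proof -
  have "\<bar>m j\<bar> \<le> int (nat \<lceil>R / s\<rceil>)" if "j < d" for j
  proof -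
    have "\<bar>s * real_of_int (m j)\<bar> \<le> R"
      using abs_le_vnorm[OF that, of "\<lambda>j. s * real_of_int (m j)"] assms by simp
    hence "real_of_int \<bar>m j\<bar> \<le> R / s" using assms(1) by (simp add: abs_mult field_simps)
    thus ?thesis by linarith
  qed
  moreover have "vnorm d (\<lambda>j. s * real_of_int (restrict m {..<d} j)) = vnorm d (\<lambda>j. s * real_of_int (m j))"
    by (simp add: vnorm_def dotp_def)
  ultimately show ?thesis using assms by (force simp: lattice_ball_def abs_le_iff)
qed

text \<open>Each lattice point of the ball has \<open>\<ell>\<^sub>1\<close>-norm at most \<open>sqrt d * R\<close>, hence weight at least
  \<open>1\<close> under the product weight \<open>\<Prod>j<d. exp (1 - \<bar>m j\<bar> / A)\<close> with \<open>A = R / (s * sqrt d)\<close>.\<close>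

lemma card_lattice_ball_le:
  assumes "d > 0" "s > 0" "R > 0"
  shows "real (card (lattice_ball d s R)) \<le> (2 * exp 1 * (R / (s * sqrt d) + 1)) ^ d"
proof -
  define A where "A = R / (s * sqrt d)"
  define B where "B = nat \<lceil>R / s\<rceil>"
  define P where "P = PiE {..<d} (\<lambda>_. {- int B..int B})"
  have A: "A > 0" using assms by (simp add: A_def)
  have finP: "finite P" unfolding P_def by (intro finite_PiE) auto
  have sub: "lattice_ball d s R \<subseteq> P" by (auto simp: lattice_ball_def P_def B_def)
  have w: "1 \<le> (\<Prod>j<d. exp (1 - \<bar>real_of_int (m j)\<bar> / A))" if "m \<in> lattice_ball d s R" for m
  proof -
    have "s * (\<Sum>j<d. \<bar>real_of_int (m j)\<bar>) = (\<Sum>j<d. \<bar>s * real_of_int (m j)\<bar>)"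
      using assms by (simp add: abs_mult sum_distrib_left)
    also have "\<dots> \<le> sqrt d * vnorm d (\<lambda>j. s * real_of_int (m j))" by (rule sum_abs_le_vnorm)
    also have "\<dots> \<le> sqrt d * R"
      using that by (intro mult_left_mono) (auto simp: lattice_ball_def)
    finally have "(\<Sum>j<d. \<bar>real_of_int (m j)\<bar>) \<le> sqrt d * R / s" using assms by (simp add: field_simps)
    also have "\<dots> = real d * A"
      using assms by (simp add: A_def field_simps flip: power2_eq_square)
    finally have "(\<Sum>j<d. \<bar>real_of_int (m j)\<bar>) / A \<le> real d" using A by (simp add: field_simps)
    hence "0 \<le> (\<Sum>j<d. 1 - \<bar>real_of_int (m j)\<bar> / A)"
      by (simp add: sum_subtractf sum_divide_distrib)
    thus ?thesis by (simp add: exp_sum[symmetric])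
  qed
  have "real (card (lattice_ball d s R)) = (\<Sum>m\<in>lattice_ball d s R. 1)" by simp
  also have "\<dots> \<le> (\<Sum>m\<in>lattice_ball d s R. \<Prod>j<d. exp (1 - \<bar>real_of_int (m j)\<bar> / A))"
    by (intro sum_mono w)
  \<comment> \<open>On the whole box the product weight factorises into one sum per
    coordinate.\<close>
  also have "\<dots> \<le> (\<Sum>m\<in>P. \<Prod>j<d. exp (1 - \<bar>real_of_int (m j)\<bar> / A))"
    by (intro sum_mono2 finP sub prod_nonneg) auto
  also have "\<dots> = (\<Prod>j<d. \<Sum>t\<in>{- int B..int B}. exp (1 - \<bar>real_of_int t\<bar> / A))"
    unfolding P_def by (rule prod_sum_PiE[symmetric]) auto
  also have "\<dots> \<le> (\<Prod>j<d. exp 1 * (2 * (A + 1)))"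
  proof (intro prod_mono conjI)
    have "(\<Sum>t\<in>{- int B..int B}. exp (1 - \<bar>real_of_int t\<bar> / A)) =
        exp 1 * (\<Sum>t\<in>{- int B..int B}. exp (- (\<bar>real_of_int t\<bar> / A)))"
      by (simp add: sum_distrib_left flip: exp_add)
    also have "\<dots> \<le> exp 1 * (2 * (A + 1))" by (intro mult_left_mono sum_exp_abs_le A) auto
    finally show "(\<Sum>t\<in>{- int B..int B}. exp (1 - \<bar>real_of_int t\<bar> / A)) \<le> exp 1 * (2 * (A + 1))" .
  qed (auto intro: sum_nonneg)
  finally show ?thesis by (simp add: A_def mult_ac)
qed

text \<open>Rounding every coordinate of \<open>F / \<bar>F\<bar>\<close> away from zero, in the direction of the sign of that
  coordinate of \<open>F\<close>, can only increase the scalar product with \<open>F\<close>.\<close>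

lemma ex_lattice_norming:
  assumes "e > 0"
  shows "\<exists>m\<in>lattice_ball e (1 / sqrt e) 2. vnorm e F \<le> dotp e (\<lambda>j. 1 / sqrt e * real_of_int (m j)) F"
proof (cases "vnorm e F = 0")
  case True
  have "restrict (\<lambda>_. 0) {..<e} \<in> lattice_ball e (1 / sqrt e) 2"
    using assms by (intro lattice_ballI) (auto simp: vnorm_def dotp_def)
  thus ?thesis using True by (intro bexI) (auto simp: dotp_def)
next
  case False
  hence pos: "vnorm e F > 0" using vnorm_nonneg[of e F] by simp
  define s where "s = 1 / sqrt (real e)"
  define z where "z = (\<lambda>j. 1 / vnorm e F * F j)"
  define m where "m j = (if F j \<ge> 0 then \<lceil>z j / s\<rceil> else \<lfloor>z j / s\<rfloor>)" for j
  have s: "s > 0" using assms by (simp add: s_def)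
  have z: "vnorm e z = 1" unfolding z_def vnorm_scale using pos by simp
  have diff: "\<bar>s * real_of_int (m j) - z j\<bar> \<le> s" for j
  proof -
    have "\<bar>real_of_int (m j) - z j / s\<bar> \<le> 1" unfolding m_def
      by (cases "F j \<ge> 0") (simp_all only: if_True if_False, linarith+)
    hence "s * \<bar>real_of_int (m j) - z j / s\<bar> \<le> s * 1" using s by (intro mult_left_mono) auto
    also have "s * \<bar>real_of_int (m j) - z j / s\<bar> = \<bar>s * (real_of_int (m j) - z j / s)\<bar>"
      using s by (simp add: abs_mult)
    also have "s * (real_of_int (m j) - z j / s) = s * real_of_int (m j) - z j"
      using s by (simp add: field_simps)
    finally show ?thesis by simp
  qed
  have "vnorm e (\<lambda>j. s * real_of_int (m j)) = vnorm e (\<lambda>j. z j + (s * real_of_int (m j) - z j))" by simp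
  also have "\<dots> \<le> vnorm e z + vnorm e (\<lambda>j. s * real_of_int (m j) - z j)" by (rule vnorm_triangle)
  \<comment> \<open>With spacing \<open>1 / sqrt e\<close> the rounding error has norm at most
    \<open>1\<close>, hence the radius \<open>2\<close>.\<close>
  also have "\<dots> \<le> 1 + s * sqrt e" using s diff by (intro add_mono vnorm_le_bound) (auto simp: z)
  also have "s * sqrt e = 1" using assms by (simp add: s_def)
  finally have mem: "restrict m {..<e} \<in> lattice_ball e s 2"
    using s by (intro lattice_ballI) auto
  have "z j * F j \<le> s * real_of_int (m j) * F j" for j
  proof (cases "F j \<ge> 0")
    case True
    have "z j / s \<le> real_of_int (m j)" using True by (simp add: m_def)
    hence "z j \<le> s * real_of_int (m j)" using s by (simp add: field_simps)
    thus ?thesis using True by (rule mult_right_mono)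
  next
    case False
    have "real_of_int (m j) \<le> z j / s" using False by (simp add: m_def)
    hence "s * real_of_int (m j) \<le> z j" using s by (simp add: field_simps)
    thus ?thesis using False by (intro mult_right_mono_neg) auto
  qed
  hence "dotp e z F \<le> dotp e (\<lambda>j. s * real_of_int (restrict m {..<e} j)) F"
    unfolding dotp_def by (intro sum_mono) simp
  moreover have "dotp e z F = vnorm e F"
    unfolding z_def dotp_scale_left using pos by (simp add: vnorm_power2[symmetric] power2_eq_square)
  ultimately show ?thesis using mem by (intro bexI) (auto simp: s_def)
qed

text \<open>Jensen's inequality from the tangent of \<open>exp\<close> at the mean; used for the
  cube average and for the denominator of attention.\<close>

lemma exp_mean_le:
  fixes X :: "'a \<Rightarrow> real"
  assumes "finite P" "P \<noteq> {}"
  shows "real (card P) * exp ((\<Sum>m\<in>P. X m) / real (card P)) \<le> (\<Sum>m\<in>P. exp (X m))"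
proof -
  define \<mu> where "\<mu> = (\<Sum>m\<in>P. X m) / real (card P)"
  have c: "real (card P) > 0" using assms by (simp add: card_gt_0_iff)
  have "exp \<mu> * (1 + (X m - \<mu>)) \<le> exp (X m)" for m
  proof -
    have "exp \<mu> * (1 + (X m - \<mu>)) \<le> exp \<mu> * exp (X m - \<mu>)"
      by (intro mult_left_mono exp_ge_add_one_self) auto
    thus ?thesis by (simp flip: exp_add)
  qed
  hence "(\<Sum>m\<in>P. exp \<mu> * (1 + (X m - \<mu>))) \<le> (\<Sum>m\<in>P. exp (X m))" by (intro sum_mono)
  moreover have "(\<Sum>m\<in>P. exp \<mu> * (1 + (X m - \<mu>))) = exp \<mu> * (real (card P) + ((\<Sum>m\<in>P. X m) - real (card P) * \<mu>))"
    by (simp add: sum_distrib_left[symmetric] sum.distrib sum_subtractf)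
  ultimately show ?thesis using c by (simp add: \<mu>_def mult.commute)
qed

definition signed_sum :: "nat \<Rightarrow> ('a \<Rightarrow> nat \<Rightarrow> real) \<Rightarrow> ('a \<Rightarrow> nat \<Rightarrow> real) \<Rightarrow> 'a set \<Rightarrow> ('a \<Rightarrow> real) \<Rightarrow>
    (nat \<Rightarrow> real) \<Rightarrow> nat \<Rightarrow> real" where
  "signed_sum d k v S \<sigma> q = (\<lambda>j. \<Sum>i\<in>S. \<sigma> i * exp (dotp d q (k i)) * v i j)"

text \<open>Averaging \<open>exp (dotp d y k)\<close> over a cube of lattice points \<open>y\<close> around \<open>q\<close> multiplies
  \<open>exp (dotp d q k)\<close> by a factor \<open>h\<close> that depends on \<open>k\<close> only. So the signed sum at \<open>q\<close> is the mean
  over the cube of the signed sums with the values \<open>v i / h i\<close>, and Jensen's inequality bounds its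
  exponential by a sum over all lattice points, at the cost of dividing by the size of the cube.\<close>

lemma lattice_signs_bound:
  assumes "d > 0" "e > 0" "N > 0" "\<rho> \<ge> 1" and fin: "finite S"
    and k: "\<And>i. i \<in> S \<Longrightarrow> vnorm d (k i) \<le> 1" and v: "\<And>i. i \<in> S \<Longrightarrow> vnorm e (v i) \<le> 1"
  defines "s \<equiv> 1 / (real N * sqrt d)"
  shows "\<exists>\<sigma>. (\<forall>i\<in>S. \<bar>\<sigma> i\<bar> = 1) \<and> (\<forall>m. vnorm d (\<lambda>j. s * real_of_int (m j)) \<le> \<rho> \<longrightarrow>
     vnorm e (signed_sum d k v S \<sigma> (\<lambda>j. s * real_of_int (m j))) \<le> 651 * exp \<rho> * sqrt (\<rho> * real (d + e)))"
proof -
  have s: "s > 0" using assms by (simp add: s_def)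
  define pt where "pt m = (\<lambda>j. s * real_of_int (m j))" for m :: "nat \<Rightarrow> int"
  define P where "P = PiE {..<d} (\<lambda>_. {- int N..int N})"
  have finP: "finite P" unfolding P_def by (intro finite_PiE) auto
  have cardP: "real (card P) = (2 * real N + 1) ^ d"
    unfolding P_def by (subst card_PiE) (auto simp: add.commute)
  define h where "h i = (\<Sum>m\<in>P. exp (dotp d (pt m) (k i))) / real (card P)" for i
  have h1: "h i \<ge> 1" for i
  proof -
    have "(2 * real N + 1) ^ d = (\<Prod>j<d. 2 * real N + 1)" by simp
    also have "\<dots> \<le> (\<Prod>j<d. \<Sum>t\<in>{- int N..int N}. exp (s * k i j * real_of_int t))"
      by (intro prod_mono conjI sum_exp_sym_ge) auto
    also have "\<dots> = (\<Sum>m\<in>P. \<Prod>j<d. exp (s * k i j * real_of_int (m j)))"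
      unfolding P_def by (rule prod_sum_PiE) auto
    also have "\<dots> = (\<Sum>m\<in>P. exp (dotp d (pt m) (k i)))"
      by (simp add: dotp_def pt_def exp_sum mult_ac)
    finally show ?thesis unfolding h_def cardP by simp
  qed
  define v' where "v' i = (\<lambda>j. 1 / h i * v i j)" for i
  have v': "vnorm e (v' i) \<le> 1" if "i \<in> S" for i
  proof -
    have "\<bar>1 / h i\<bar> * vnorm e (v i) \<le> 1 * 1"
      using h1[of i] v[OF that] vnorm_nonneg by (intro mult_mono) auto
    thus ?thesis unfolding v'_def vnorm_scale by simp
  qed
  interpret exp_kernel S d e \<rho> k v'
    by unfold_locales (use fin k v' \<open>\<rho> \<ge> 1\<close> in auto)
  \<comment> \<open>Radius \<open>\<rho> + 1\<close> leaves room for a cube of radius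
    \<open>1\<close> around each query; \<open>Z\<close> holds norming directions for the
    values.\<close>
  define Y where "Y = lattice_ball d s (\<rho> + 1)"
  define Z where "Z = lattice_ball e (1 / sqrt e) 2"
  define zt where "zt m = (\<lambda>j. 1 / sqrt e * real_of_int (m j))" for m :: "nat \<Rightarrow> int"
  \<comment> \<open>At this scale \<open>l\<close> times the target discrepancy is a multiple of
    \<open>\<rho> * real (d + e)\<close>, the order both of \<open>M\<close> and of the logarithm of
    \<open>card Y * card Z / card P\<close>.\<close>
  define l where "l = exp (- \<rho>) * sqrt (\<rho> * real (d + e))"
  have l: "l > 0" using assms by (simp add: l_def)
  define a where "a \<theta> i = l * (exp (dotp d (pt (fst \<theta>)) (k i)) * dotp e (zt (snd \<theta>)) (v' i))" for \<theta> i
  \<comment> \<open>\<open>2 * \<rho> + 3\<close> bounds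
    \<open>\<rho> + (\<rho> + 1)\<^sup>2 / \<rho>\<close>, and \<open>4\<close> is the squared
    radius of \<open>Z\<close>.\<close>
  define M where "M = l\<^sup>2 * (exp (2 * \<rho> + 3) * 4)"
  have dual: "2 * pair (a \<theta>) x - form x x \<le> M" if "\<theta> \<in> Y \<times> Z" for \<theta> x
  proof -
    have n1: "vnorm d (pt (fst \<theta>)) \<le> \<rho> + 1" and n2: "vnorm e (zt (snd \<theta>)) \<le> 2"
      using that by (auto simp: Y_def Z_def lattice_ball_def pt_def zt_def)
    have "(vnorm d (pt (fst \<theta>)))\<^sup>2 / \<rho> \<le> (\<rho> + 1)\<^sup>2 / \<rho>"
      using n1 vnorm_nonneg \<open>\<rho> \<ge> 1\<close> by (intro divide_right_mono power_mono) auto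
    also have "\<dots> \<le> \<rho> + 3" using \<open>\<rho> \<ge> 1\<close> by (simp add: field_simps power2_eq_square)
    finally have 1: "(vnorm d (pt (fst \<theta>)))\<^sup>2 / \<rho> \<le> \<rho> + 3" .
    have 2: "(vnorm e (zt (snd \<theta>)))\<^sup>2 \<le> 2\<^sup>2" using n2 vnorm_nonneg by (intro power_mono) auto
    have "2 * pair (a \<theta>) x - form x x \<le> l\<^sup>2 * (exp (\<rho> + (vnorm d (pt (fst \<theta>)))\<^sup>2 / \<rho>) * (vnorm e (zt (snd \<theta>)))\<^sup>2)"
      unfolding pair_def form_def a_def using \<rho>_pos fin by (intro exp_kernel_dual_bound)
    also have "\<dots> \<le> M" unfolding M_def using 1 2 by (intro mult_left_mono mult_mono) auto
    finally show ?thesis .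
  qed
  obtain \<sigma> where \<sigma>: "\<forall>i\<in>S. \<bar>\<sigma> i\<bar> = 1"
    "(\<Sum>\<theta>\<in>Y \<times> Z. exp (pair (a \<theta>) \<sigma>)) \<le> (\<Sum>\<theta>\<in>Y \<times> Z. exp (6 * M))"
    using subgaussian_signs[of "Y \<times> Z" a "\<lambda>_. M", OF dual] by blast
  have finYZ: "finite Y" "finite Z" by (simp_all add: Y_def Z_def finite_lattice_ball)
  have main: "vnorm e (signed_sum d k v S \<sigma> (pt m0)) \<le> 651 * exp \<rho> * sqrt (\<rho> * real (d + e))"
    if m0: "vnorm d (pt m0) \<le> \<rho>" for m0
  proof -
    define F where "F = signed_sum d k v S \<sigma> (pt m0)"
    obtain z where z: "z \<in> Z" "vnorm e F \<le> dotp e (zt z) F"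
      using ex_lattice_norming[OF \<open>e > 0\<close>, of F] by (auto simp: Z_def zt_def)
    define sh where "sh m = restrict (\<lambda>j. m0 j + m j) {..<d}" for m
    have pt_sh: "dotp d (pt (sh m)) y = dotp d (pt m0) y + dotp d (pt m) y" for m y
      by (simp add: dotp_def pt_def sh_def algebra_simps sum.distrib)
    have pt_P: "vnorm d (pt m) \<le> 1" if "m \<in> P" for m
    proof -
      have "\<bar>pt m j\<bar> \<le> s * real N" if "j < d" for j
      proof -
        have "\<bar>m j\<bar> \<le> int N" using \<open>m \<in> P\<close> that by (auto simp: P_def PiE_def Pi_def abs_le_iff)
        hence "\<bar>real_of_int (m j)\<bar> \<le> real N" by linarith
        thus ?thesis using s by (simp add: pt_def abs_mult)
      qed
      hence "vnorm d (pt m) \<le> s * real N * sqrt d" using s by (intro vnorm_le_bound) auto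
      also have "\<dots> = 1" using assms by (simp add: s_def)
      finally show ?thesis .
    qed
    have sh_Y: "sh m \<in> Y" if "m \<in> P" for m
    proof -
      have "vnorm d (\<lambda>j. pt m0 j + pt m j) \<le> \<rho> + 1"
        using vnorm_triangle[of d "pt m0" "pt m"] m0 pt_P[OF that] by linarith
      hence "vnorm d (\<lambda>j. s * real_of_int (m0 j + m j)) \<le> \<rho> + 1" by (simp add: pt_def algebra_simps)
      thus ?thesis unfolding Y_def sh_def by (rule lattice_ballI[OF s])
    qed
    have inj: "inj_on sh P"
    proof (rule inj_onI)
      fix m m' assume mm: "m \<in> P" "m' \<in> P" "sh m = sh m'"
      have "m j = m' j" if "j < d" for j
        using fun_cong[OF mm(3), of j] that by (simp add: sh_def)
      thus "m = m'" using mm(1,2) unfolding P_def by (intro PiE_ext) auto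
    qed
    have mean: "(\<Sum>m\<in>P. pair (a (sh m, z)) \<sigma>) = real (card P) * (l * dotp e (zt z) F)"
    proof -
      have "(\<Sum>m\<in>P. pair (a (sh m, z)) \<sigma>) =
          (\<Sum>i\<in>S. \<Sum>m\<in>P. l * \<sigma> i * exp (dotp d (pt m0) (k i)) * dotp e (zt z) (v' i) * exp (dotp d (pt m) (k i)))"
        unfolding pair_def a_def by (subst sum.swap) (simp add: pt_sh exp_add mult_ac)
      also have "\<dots> = (\<Sum>i\<in>S. l * \<sigma> i * exp (dotp d (pt m0) (k i)) * dotp e (zt z) (v' i) * (real (card P) * h i))"
        using cardP assms by (simp add: sum_distrib_left[symmetric] h_def)
      also have "\<dots> = (\<Sum>i\<in>S. real (card P) * (l * (\<sigma> i * exp (dotp d (pt m0) (k i)) * dotp e (zt z) (v i))))"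
      proof (intro sum.cong refl)
        fix i
        have "dotp e (zt z) (v' i) * h i = dotp e (zt z) (v i)"
          unfolding v'_def dotp_scale_right using h1[of i] by simp
        moreover have "l * \<sigma> i * exp (dotp d (pt m0) (k i)) * dotp e (zt z) (v' i) * (real (card P) * h i) =
            real (card P) * (l * (\<sigma> i * exp (dotp d (pt m0) (k i)) * (dotp e (zt z) (v' i) * h i)))"
          by simp
        ultimately show "l * \<sigma> i * exp (dotp d (pt m0) (k i)) * dotp e (zt z) (v' i) * (real (card P) * h i) =
            real (card P) * (l * (\<sigma> i * exp (dotp d (pt m0) (k i)) * dotp e (zt z) (v i)))"
          by simp
      qed
      also have "\<dots> = real (card P) * (l * dotp e (zt z) F)"
        unfolding F_def signed_sum_def dotp_sum_right by (simp add: sum_distrib_left)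
      finally show ?thesis .
    qed
    have cP: "real (card P) > 0" by (simp add: cardP add_pos_nonneg)
    hence Pne: "P \<noteq> {}" by auto
    have "real (card P) * exp (l * vnorm e F) \<le> real (card P) * exp (l * dotp e (zt z) F)"
      using z l by (intro mult_left_mono) auto
    also have "\<dots> = real (card P) * exp ((\<Sum>m\<in>P. pair (a (sh m, z)) \<sigma>) / real (card P))"
      using cP by (simp add: mean)
    also have "\<dots> \<le> (\<Sum>m\<in>P. exp (pair (a (sh m, z)) \<sigma>))"
      by (rule exp_mean_le[OF finP Pne])
    also have "\<dots> = (\<Sum>\<theta>\<in>(\<lambda>m. (sh m, z)) ` P. exp (pair (a \<theta>) \<sigma>))"
      using inj by (subst sum.reindex) (auto simp: inj_on_def)
    also have "\<dots> \<le> (\<Sum>\<theta>\<in>Y \<times> Z. exp (pair (a \<theta>) \<sigma>))"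
      using finYZ sh_Y z by (intro sum_mono2) auto
    also have "\<dots> \<le> real (card Y) * real (card Z) * exp (6 * M)"
      using \<sigma>(2) by (simp add: card_cartesian_product)
    also have "\<dots> \<le> ((2 * exp 1 * ((\<rho> + 1) * real N + 1)) ^ d) * (2 * exp 1 * 3) ^ e * exp (6 * M)"
    proof (intro mult_right_mono mult_mono)
      have "(\<rho> + 1) / (s * sqrt d) = (\<rho> + 1) * real N" using assms by (simp add: s_def)
      thus "real (card Y) \<le> (2 * exp 1 * ((\<rho> + 1) * real N + 1)) ^ d"
        using card_lattice_ball_le[of d s "\<rho> + 1"] assms(1) s \<open>\<rho> \<ge> 1\<close> unfolding Y_def by simp
      show "real (card Z) \<le> (2 * exp 1 * 3) ^ e"
        using card_lattice_ball_le[of e "1 / sqrt e" 2] \<open>e > 0\<close> unfolding Z_def by simp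
    qed (use \<open>\<rho> \<ge> 1\<close> in auto)
    \<comment> \<open>Dividing by the size of the cube will remove \<open>N\<close>:
      \<open>Y\<close> outnumbers \<open>P\<close> by at most a factor
      \<open>exp (3 * \<rho>)\<close> per coordinate, however fine the lattice.\<close>
    also have "\<dots> \<le> (real (card P) * exp (3 * \<rho>) ^ d) * exp 3 ^ e * exp (6 * M)"
    proof (intro mult_right_mono mult_mono)
      have "2 * exp 1 * ((\<rho> + 1) * real N + 1) \<le> exp 1 * ((2 * real N + 1) * (\<rho> + 2))"
        using \<open>\<rho> \<ge> 1\<close> by (simp add: algebra_simps)
      also have "\<rho> + 2 \<le> exp (\<rho> + 1)" using exp_ge_add_one_self[of "\<rho> + 1"] by simp
      also have "exp 1 * ((2 * real N + 1) * exp (\<rho> + 1)) = (2 * real N + 1) * exp (\<rho> + 2)"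
        by (simp flip: exp_add)
      also have "exp (\<rho> + 2) \<le> exp (3 * \<rho>)" using \<open>\<rho> \<ge> 1\<close> by simp
      finally have "2 * exp 1 * ((\<rho> + 1) * real N + 1) \<le> (2 * real N + 1) * exp (3 * \<rho>)"
        by (simp add: mult_left_mono)
      hence "(2 * exp 1 * ((\<rho> + 1) * real N + 1)) ^ d \<le> ((2 * real N + 1) * exp (3 * \<rho>)) ^ d"
        using \<open>\<rho> \<ge> 1\<close> by (intro power_mono) auto
      thus "(2 * exp 1 * ((\<rho> + 1) * real N + 1)) ^ d \<le> real (card P) * exp (3 * \<rho>) ^ d"
        by (simp add: cardP power_mult_distrib)
      have "(1 + 1 + 1\<^sup>2 / 2) \<le> exp (1::real)" by (rule exp_lower_Taylor_quadratic) simp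
      hence "(5 / 2) * (5 / 2) \<le> exp 1 * exp (1::real)" by (intro mult_mono) auto
      hence "2 * exp 1 * 3 \<le> exp 1 * (exp 1 * exp (1::real))" by simp
      also have "\<dots> = exp 3" by (simp flip: exp_add)
      finally show "(2 * exp 1 * 3) ^ e \<le> exp (3::real) ^ e" by (intro power_mono) auto
    qed (use \<open>\<rho> \<ge> 1\<close> in auto)
    also have "\<dots> = real (card P) * exp (3 * \<rho> * real d + 3 * real e + 6 * M)"
      by (simp add: exp_add exp_of_nat_mult[symmetric] mult_ac)
    finally have "l * vnorm e F \<le> 3 * \<rho> * real d + 3 * real e + 6 * M" using cP by simp
    also have "3 * \<rho> * real d + 3 * real e \<le> 3 * (\<rho> * real (d + e))"
    proof -
      have "1 * real e \<le> \<rho> * real e" using \<open>\<rho> \<ge> 1\<close> by (intro mult_right_mono) auto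
      thus ?thesis by (simp add: algebra_simps)
    qed
    \<comment> \<open>\<open>648 = 6 * 4 * 27\<close>; with the \<open>3\<close> from the counting
      bounds this gives \<open>651\<close>.\<close>
    also have "6 * M \<le> 648 * (\<rho> * real (d + e))"
    proof -
      have "M = \<rho> * real (d + e) * (exp (- \<rho>) * exp (- \<rho>) * exp (2 * \<rho> + 3) * 4)"
      proof -
        have "(sqrt (\<rho> * real (d + e)))\<^sup>2 = \<rho> * real (d + e)" using \<open>\<rho> \<ge> 1\<close> by simp
        thus ?thesis unfolding M_def l_def power_mult_distrib by (simp only: power2_eq_square mult_ac)
      qed
      also have "exp (- \<rho>) * exp (- \<rho>) * exp (2 * \<rho> + 3) = exp 3" by (simp flip: exp_add)
      also have "exp (3::real) \<le> 27"
      proof -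
        have "exp (3::real) = exp 1 ^ 3" by (simp add: exp_of_nat_mult[symmetric])
        also have "\<dots> \<le> 3 ^ 3" using exp_le by (intro power_mono) auto
        finally show ?thesis by simp
      qed
      finally show ?thesis using \<open>\<rho> \<ge> 1\<close> by (simp add: mult_left_mono)
    qed
    finally have "l * vnorm e F \<le> 651 * (\<rho> * real (d + e))" by simp
    also have "\<dots> = l * (651 * exp \<rho> * sqrt (\<rho> * real (d + e)))"
    proof -
      have "sqrt (\<rho> * real (d + e)) * sqrt (\<rho> * real (d + e)) = \<rho> * real (d + e)"
        using \<open>\<rho> \<ge> 1\<close> by simp
      moreover have "l * (651 * exp \<rho> * sqrt (\<rho> * real (d + e))) =
          651 * (exp (- \<rho>) * exp \<rho>) * (sqrt (\<rho> * real (d + e)) * sqrt (\<rho> * real (d + e)))"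
        unfolding l_def by (simp only: mult_ac)
      ultimately show ?thesis by (simp flip: exp_add)
    qed
    finally show ?thesis using l unfolding F_def by simp
  qed
  show ?thesis using \<sigma>(1) main unfolding pt_def by (intro exI[of _ \<sigma>]) auto
qed

section \<open>From lattice queries to all queries\<close>

lemma abs_exp_diff_le:
  assumes "a \<le> r" "b \<le> (r::real)"
  shows "\<bar>exp a - exp b\<bar> \<le> exp r * \<bar>a - b\<bar>"
proof -
  have aux: "exp a - exp b \<le> exp r * \<bar>a - b\<bar>" if "a \<le> r" for a b :: real
  proof -
    have "exp a * (1 + (b - a)) \<le> exp a * exp (b - a)" by (intro mult_left_mono exp_ge_add_one_self) auto
    hence "exp a - exp b \<le> exp a * (a - b)" by (simp add: algebra_simps flip: exp_add)
    also have "\<dots> \<le> exp a * \<bar>a - b\<bar>" by (intro mult_left_mono) auto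
    also have "\<dots> \<le> exp r * \<bar>a - b\<bar>" using that by (intro mult_right_mono) auto
    finally show ?thesis .
  qed
  show ?thesis using aux[OF assms(1), of b] aux[OF assms(2), of a] by (simp add: abs_if split: if_splits)
qed

text \<open>Rounding towards zero keeps the query inside the ball.\<close>

lemma ex_lattice_round:
  assumes "s > 0"
  obtains m :: "nat \<Rightarrow> int" where "\<And>j. \<bar>s * real_of_int (m j)\<bar> \<le> \<bar>q j\<bar>" "\<And>j. \<bar>q j - s * real_of_int (m j)\<bar> \<le> s"
proof -
  define m where "m j = (if q j \<ge> 0 then \<lfloor>q j / s\<rfloor> else \<lceil>q j / s\<rceil>)" for j
  have "\<bar>s * real_of_int (m j)\<bar> \<le> \<bar>q j\<bar> \<and> \<bar>q j - s * real_of_int (m j)\<bar> \<le> s" for j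
  proof (cases "q j \<ge> 0")
    case True
    have "real_of_int (m j) \<le> q j / s" "q j / s \<le> real_of_int (m j) + 1" "0 \<le> m j"
      using True assms by (simp_all add: m_def)
    hence "s * real_of_int (m j) \<le> q j" "q j \<le> s * real_of_int (m j) + s" "0 \<le> s * real_of_int (m j)"
      using assms by (simp_all add: field_simps)
    thus ?thesis using True by auto
  next
    case False
    hence "q j / s < 0" using assms by (simp add: divide_neg_pos)
    have "q j / s \<le> real_of_int (m j)" "real_of_int (m j) \<le> q j / s + 1" "m j \<le> 0"
      using False \<open>q j / s < 0\<close> by (simp_all add: m_def)
    hence "q j \<le> s * real_of_int (m j)" "s * real_of_int (m j) \<le> q j + s" "s * real_of_int (m j) \<le> 0"
      using assms by (simp_all add: field_simps mult_nonneg_nonpos)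
    thus ?thesis using False by auto
  qed
  thus ?thesis using that by blast
qed

lemma ball_signs_bound:
  assumes "d > 0" "e > 0" "\<rho> \<ge> 1" and fin: "finite S"
    and k: "\<And>i. i \<in> S \<Longrightarrow> vnorm d (k i) \<le> 1" and v: "\<And>i. i \<in> S \<Longrightarrow> vnorm e (v i) \<le> 1"
  shows "\<exists>\<sigma>. (\<forall>i\<in>S. \<bar>\<sigma> i\<bar> = 1) \<and> (\<forall>q. vnorm d q \<le> \<rho> \<longrightarrow>
     vnorm e (signed_sum d k v S \<sigma> q) \<le> 651 * exp \<rho> * sqrt (\<rho> * real (d + e)) + 1)"
proof -
  \<comment> \<open>So fine a lattice that \<open>card S\<close> terms, each off by at most
    \<open>exp \<rho> / N\<close>, err by at most \<open>1\<close> in total. The bound on the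
    lattice does not depend on \<open>N\<close>.\<close>
  define N where "N = Suc (nat \<lceil>real (card S) * exp \<rho>\<rceil>)"
  define s where "s = 1 / (real N * sqrt d)"
  have N: "N > 0" "real (card S) * exp \<rho> \<le> real N" unfolding N_def by (simp, linarith)
  have s: "s > 0" "s * sqrt d = 1 / real N" using assms N by (auto simp: s_def)
  obtain \<sigma> where \<sigma>: "\<forall>i\<in>S. \<bar>\<sigma> i\<bar> = 1"
    "\<And>m. vnorm d (\<lambda>j. s * real_of_int (m j)) \<le> \<rho> \<Longrightarrow>
     vnorm e (signed_sum d k v S \<sigma> (\<lambda>j. s * real_of_int (m j))) \<le> 651 * exp \<rho> * sqrt (\<rho> * real (d + e))"
    using lattice_signs_bound[of d e N \<rho> S k v] assms N unfolding s_def by blast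
  have "vnorm e (signed_sum d k v S \<sigma> q) \<le> 651 * exp \<rho> * sqrt (\<rho> * real (d + e)) + 1"
    if q: "vnorm d q \<le> \<rho>" for q
  proof -
    obtain m where m: "\<And>j. \<bar>s * real_of_int (m j)\<bar> \<le> \<bar>q j\<bar>" "\<And>j. \<bar>q j - s * real_of_int (m j)\<bar> \<le> s"
      using ex_lattice_round[OF s(1)] by metis
    define q' where "q' = (\<lambda>j. s * real_of_int (m j))"
    have q': "vnorm d q' \<le> \<rho>" using vnorm_mono[of d q' q] m(1) q by (simp add: q'_def)
    have qq': "vnorm d (\<lambda>j. q j - q' j) \<le> 1 / real N"
      using vnorm_le_bound[of d "\<lambda>j. q j - q' j" s] m(2) s by (simp add: q'_def)
    define w where "w i = \<sigma> i * (exp (dotp d q (k i)) - exp (dotp d q' (k i)))" for i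
    have w: "\<bar>w i\<bar> \<le> exp \<rho> / real N" if i: "i \<in> S" for i
    proof -
      have le: "dotp d x (k i) \<le> \<rho>" if "vnorm d x \<le> \<rho>" for x
      proof -
        have "dotp d x (k i) \<le> vnorm d x * vnorm d (k i)" using abs_dotp_le[of d x "k i"] by linarith
        also have "\<dots> \<le> \<rho> * 1" using that k[OF i] vnorm_nonneg \<open>\<rho> \<ge> 1\<close> by (intro mult_mono) auto
        finally show ?thesis by simp
      qed
      have "\<bar>dotp d q (k i) - dotp d q' (k i)\<bar> \<le> vnorm d (\<lambda>j. q j - q' j) * vnorm d (k i)"
        using abs_dotp_le[of d "\<lambda>j. q j - q' j" "k i"] by (simp add: dotp_diff_left)
      also have "\<dots> \<le> 1 / real N * 1" using qq' k[OF i] vnorm_nonneg by (intro mult_mono) auto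
      finally have "exp \<rho> * \<bar>dotp d q (k i) - dotp d q' (k i)\<bar> \<le> exp \<rho> * (1 / real N)"
        by (intro mult_left_mono) auto
      thus ?thesis using abs_exp_diff_le[OF le[OF q] le[OF q']] \<sigma>(1) i
        by (simp add: w_def abs_mult)
    qed
    have "signed_sum d k v S \<sigma> q = (\<lambda>j. signed_sum d k v S \<sigma> q' j + (\<Sum>i\<in>S. w i * v i j))"
      by (simp add: signed_sum_def w_def algebra_simps flip: sum.distrib)
    hence "vnorm e (signed_sum d k v S \<sigma> q) \<le> vnorm e (signed_sum d k v S \<sigma> q') + vnorm e (\<lambda>j. \<Sum>i\<in>S. w i * v i j)"
      using vnorm_triangle[of e "signed_sum d k v S \<sigma> q'" "\<lambda>j. \<Sum>i\<in>S. w i * v i j"] by simp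
    also have "vnorm e (\<lambda>j. \<Sum>i\<in>S. w i * v i j) \<le> (\<Sum>i\<in>S. vnorm e (\<lambda>j. w i * v i j))"
      by (rule vnorm_sum_le[OF fin])
    also have "\<dots> \<le> (\<Sum>i\<in>S. exp \<rho> / real N * 1)"
      unfolding vnorm_scale using w v vnorm_nonneg by (intro sum_mono mult_mono) auto
    also have "\<dots> \<le> 1" using N by (simp add: field_simps)
    also have "vnorm e (signed_sum d k v S \<sigma> q') \<le> 651 * exp \<rho> * sqrt (\<rho> * real (d + e))"
      using \<sigma>(2) q' by (simp add: q'_def)
    finally show ?thesis by simp
  qed
  thus ?thesis using \<sigma>(1) by blast
qed

section \<open>Greedy signs and a dimension-free bound\<close>

lemma (in gram) ex_signs_form_le_trace:
  assumes "T \<subseteq> S"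
  shows "\<exists>\<sigma>. (\<forall>i\<in>T. \<bar>\<sigma> i\<bar> = 1) \<and> (\<forall>i. i \<notin> T \<longrightarrow> \<sigma> i = 0) \<and> form \<sigma> \<sigma> \<le> (\<Sum>i\<in>T. G i i)"
proof -
  have "finite T" using assms finite_S finite_subset by blast
  thus ?thesis using assms
  proof (induction T rule: finite_induct)
    case empty
    show ?case by (intro exI[of _ "\<lambda>_. 0"]) (simp add: form_def)
  next
    case (insert i T)
    then obtain \<sigma> where \<sigma>: "\<forall>i\<in>T. \<bar>\<sigma> i\<bar> = 1" "\<forall>i. i \<notin> T \<longrightarrow> \<sigma> i = 0" "form \<sigma> \<sigma> \<le> (\<Sum>i\<in>T. G i i)" by auto
    \<comment> \<open>This sign makes the cross term nonpositive, so the new index adds at most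
      \<open>G i i\<close>.\<close>
    define t :: real where "t = (if form \<sigma> (unitv i) \<le> 0 then 1 else -1)"
    define \<tau> where "\<tau> = (\<lambda>j. \<sigma> j + t * unitv i j)"
    have t: "\<bar>t\<bar> = 1" "t\<^sup>2 = 1" "t * form \<sigma> (unitv i) \<le> 0" by (auto simp: t_def)
    have "form \<tau> \<tau> = form \<sigma> \<sigma> + 2 * (t * form \<sigma> (unitv i)) + G i i"
      unfolding \<tau>_def form_add_add using t(2) insert.prems by (simp add: form_unitv_unitv)
    also have "\<dots> \<le> (\<Sum>i\<in>insert i T. G i i)" using t(3) \<sigma>(3) insert.hyps by simp
    finally show ?case using \<sigma>(1,2) t(1) insert.hyps
      by (intro exI[of _ \<tau>]) (auto simp: \<tau>_def unitv_def)
  qed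
qed

text \<open>Greedy signs bound \<open>form \<sigma> \<sigma>\<close> by \<open>card S\<close>, and
  every query tests this one vector, so all queries are controlled at once.\<close>

lemma dimension_free_signs_bound:
  assumes "\<rho> > 0" and fin: "finite S"
    and k: "\<And>i. i \<in> S \<Longrightarrow> vnorm d (k i) \<le> 1" and v: "\<And>i. i \<in> S \<Longrightarrow> vnorm e (v i) \<le> 1"
  shows "\<exists>\<sigma>. (\<forall>i\<in>S. \<bar>\<sigma> i\<bar> = 1) \<and> (\<forall>q. vnorm d q \<le> \<rho> \<longrightarrow>
     vnorm e (signed_sum d k v S \<sigma> q) \<le> exp \<rho> * sqrt (real (card S)))"
proof -
  interpret exp_kernel S d e \<rho> k v
    by unfold_locales (use assms in auto)
  obtain \<sigma> where \<sigma>: "\<forall>i\<in>S. \<bar>\<sigma> i\<bar> = 1"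
    "form \<sigma> \<sigma> \<le> (\<Sum>i\<in>S. exp (\<rho> * (dotp d (k i) (k i) - 1)) * dotp e (v i) (v i))"
    using ex_signs_form_le_trace[OF order_refl] by blast
  note \<sigma>(2)
  also have "(\<Sum>i\<in>S. exp (\<rho> * (dotp d (k i) (k i) - 1)) * dotp e (v i) (v i)) \<le> (\<Sum>i\<in>S. 1)"
    by (intro sum_mono G_diag)
  finally have Q: "form \<sigma> \<sigma> \<le> real (card S)" by simp
  have "vnorm e (signed_sum d k v S \<sigma> q) \<le> exp \<rho> * sqrt (real (card S))" if q: "vnorm d q \<le> \<rho>" for q
  proof -
    define F where "F = signed_sum d k v S \<sigma> q"
    \<comment> \<open>Testing in direction \<open>F\<close> itself turns the functional into
      \<open>(vnorm e F)\<^sup>2\<close>; this \<open>l\<close> optimises the resulting quadratic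
      inequality.\<close>
    define l where "l = exp (- (2 * \<rho>))"
    have l: "l > 0" "l * exp (2 * \<rho>) = 1" by (simp_all add: l_def flip: exp_add)
    have "(\<Sum>i\<in>S. l * (exp (dotp d q (k i)) * dotp e F (v i)) * \<sigma> i) =
        l * (\<Sum>i\<in>S. (\<sigma> i * exp (dotp d q (k i))) * dotp e F (v i))"
      by (simp add: sum_distrib_left mult_ac)
    also have "(\<Sum>i\<in>S. (\<sigma> i * exp (dotp d q (k i))) * dotp e F (v i)) =
        dotp e F (signed_sum d k v S \<sigma> q)"
      unfolding signed_sum_def by (rule dotp_sum_right[symmetric])
    also have "dotp e F (signed_sum d k v S \<sigma> q) = (vnorm e F)\<^sup>2" by (simp add: F_def vnorm_power2)
    finally have "2 * (l * (vnorm e F)\<^sup>2) - form \<sigma> \<sigma> \<le> l\<^sup>2 * (exp (\<rho> + (vnorm d q)\<^sup>2 / \<rho>) * (vnorm e F)\<^sup>2)"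
      using exp_kernel_dual_bound[OF fin \<open>\<rho> > 0\<close>, of l d q k e F v \<sigma>] unfolding form_def by simp
    also have "\<dots> \<le> l\<^sup>2 * (exp (2 * \<rho>) * (vnorm e F)\<^sup>2)"
    proof -
      have "(vnorm d q)\<^sup>2 / \<rho> \<le> \<rho>\<^sup>2 / \<rho>"
        using q vnorm_nonneg \<open>\<rho> > 0\<close> by (intro divide_right_mono power_mono) auto
      hence "(vnorm d q)\<^sup>2 / \<rho> \<le> \<rho>" using \<open>\<rho> > 0\<close> by (simp add: power2_eq_square)
      thus ?thesis by (intro mult_left_mono mult_right_mono) auto
    qed
    also have "\<dots> = l * (l * exp (2 * \<rho>)) * (vnorm e F)\<^sup>2" by (simp add: power2_eq_square)
    also have "\<dots> = l * (vnorm e F)\<^sup>2" by (simp add: l)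
    finally have "l * (vnorm e F)\<^sup>2 \<le> real (card S)" using Q by simp
    hence "exp (2 * \<rho>) * (l * (vnorm e F)\<^sup>2) \<le> exp (2 * \<rho>) * real (card S)" by (intro mult_left_mono) auto
    also have "exp (2 * \<rho>) * (l * (vnorm e F)\<^sup>2) = (l * exp (2 * \<rho>)) * (vnorm e F)\<^sup>2" by simp
    also have "\<dots> = (vnorm e F)\<^sup>2" by (simp add: l)
    also have "exp (2 * \<rho>) * real (card S) = (exp \<rho> * sqrt (real (card S)))\<^sup>2"
      by (simp add: power_mult_distrib exp_double)
    finally show ?thesis unfolding F_def by (rule power2_le_imp_le) auto
  qed
  thus ?thesis using \<sigma>(1) by blast
qed

text \<open>An additional constant coordinate lets one signed sum control numerator and denominator of
  the attention at once.\<close>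

definition augment :: "nat \<Rightarrow> (nat \<Rightarrow> real) \<Rightarrow> nat \<Rightarrow> real" where
  "augment d v = (\<lambda>j. if j < d then v j / 2 else 1 / 2)"

lemma vnorm_augment_le:
  assumes "vnorm d v \<le> 1" shows "vnorm (Suc d) (augment d v) \<le> 1"
proof -
  have "(vnorm d v)\<^sup>2 \<le> 1" using assms vnorm_nonneg by (simp add: power_le_one)
  hence "dotp d v v \<le> 1" by (simp add: vnorm_power2)
  moreover have "dotp (Suc d) (augment d v) (augment d v) = dotp d v v / 4 + 1 / 4"
    by (simp add: dotp_def augment_def sum_divide_distrib)
  ultimately show ?thesis by (simp add: vnorm_def)
qed

lemma signed_sum_augment:
  assumes "vnorm (Suc d) (signed_sum d k (\<lambda>i. augment d (v i)) S \<sigma> q) \<le> D"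
  shows "\<bar>\<Sum>i\<in>S. \<sigma> i * exp (dotp d q (k i))\<bar> \<le> 2 * D" "vnorm d (signed_sum d k v S \<sigma> q) \<le> 2 * D"
proof -
  define F where "F = signed_sum d k (\<lambda>i. augment d (v i)) S \<sigma> q"
  have "(\<Sum>i\<in>S. \<sigma> i * exp (dotp d q (k i))) = 2 * F d"
    by (simp add: F_def signed_sum_def augment_def sum_distrib_left)
  thus "\<bar>\<Sum>i\<in>S. \<sigma> i * exp (dotp d q (k i))\<bar> \<le> 2 * D"
    using abs_le_vnorm[of d "Suc d" F] assms by (simp add: F_def abs_mult)
  have "vnorm d (signed_sum d k v S \<sigma> q) = vnorm d (\<lambda>j. 2 * F j)"
    unfolding vnorm_def dotp_def
    by (intro arg_cong[of _ _ sqrt] sum.cong refl)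
      (simp add: F_def signed_sum_def augment_def sum_distrib_left)
  also have "\<dots> = 2 * vnorm d F" by (simp add: vnorm_scale)
  also have "vnorm d F \<le> vnorm (Suc d) F" by (simp add: vnorm_def dotp_def)
  finally show "vnorm d (signed_sum d k v S \<sigma> q) \<le> 2 * D" using assms by (simp add: F_def)
qed

lemma ex_signs_discrepancy:
  assumes "d > 0" "\<rho> \<ge> 1" "finite S"
    and "\<And>i. i \<in> S \<Longrightarrow> vnorm d (k i) \<le> 1 \<and> vnorm d (v i) \<le> 1"
  shows "\<exists>\<sigma>. (\<forall>i\<in>S. \<bar>\<sigma> i\<bar> = 1) \<and> (\<forall>q. vnorm d q \<le> \<rho> \<longrightarrow>
     \<bar>\<Sum>i\<in>S. \<sigma> i * exp (dotp d q (k i))\<bar> \<le> 2606 * exp \<rho> * sqrt (\<rho> * real d) \<and>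
     vnorm d (signed_sum d k v S \<sigma> q) \<le> 2606 * exp \<rho> * sqrt (\<rho> * real d))"
proof -
  obtain \<sigma> where \<sigma>: "\<forall>i\<in>S. \<bar>\<sigma> i\<bar> = 1" "\<And>q. vnorm d q \<le> \<rho> \<Longrightarrow>
     vnorm (Suc d) (signed_sum d k (\<lambda>i. augment d (v i)) S \<sigma> q) \<le>
       651 * exp \<rho> * sqrt (\<rho> * real (d + Suc d)) + 1"
    using ball_signs_bound[of d "Suc d" \<rho> S k "\<lambda>i. augment d (v i)"] assms vnorm_augment_le by blast
  have "\<rho> * real (d + Suc d) \<le> 4 * (\<rho> * real d)"
    using assms(1,2) mult_left_mono[of 1 "real d" \<rho>] by (simp add: algebra_simps)
  hence "sqrt (\<rho> * real (d + Suc d)) \<le> sqrt (4 * (\<rho> * real d))" by (rule real_sqrt_le_mono)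
  also have "\<dots> = 2 * sqrt (\<rho> * real d)" by (subst real_sqrt_mult) simp
  finally have "exp \<rho> * sqrt (\<rho> * real (d + Suc d)) \<le> exp \<rho> * (2 * sqrt (\<rho> * real d))"
    by (intro mult_left_mono) auto
  moreover have "1 * 1 \<le> exp \<rho> * sqrt (\<rho> * real d)"
    using assms(1,2) mult_mono[of 1 \<rho> 1 "real d"] by (intro mult_mono) auto
  \<comment> \<open>\<open>2606 = 2 * (2 * 651 + 1)\<close>: the outer \<open>2\<close> undoes the
    halving in \<open>augment\<close>, the inner one is \<open>sqrt 4\<close>, and the summand
    \<open>1\<close> is absorbed.\<close>
  ultimately have "2 * (651 * exp \<rho> * sqrt (\<rho> * real (d + Suc d)) + 1) \<le> 2606 * exp \<rho> * sqrt (\<rho> * real d)"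
    by argo
  thus ?thesis using \<sigma>(1) signed_sum_augment[OF \<sigma>(2)] by (meson order_trans)
qed

lemma ex_signs_discrepancy_dimension_free:
  assumes "\<rho> > 0" "finite S"
    and "\<And>i. i \<in> S \<Longrightarrow> vnorm d (k i) \<le> 1 \<and> vnorm d (v i) \<le> 1"
  shows "\<exists>\<sigma>. (\<forall>i\<in>S. \<bar>\<sigma> i\<bar> = 1) \<and> (\<forall>q. vnorm d q \<le> \<rho> \<longrightarrow>
     \<bar>\<Sum>i\<in>S. \<sigma> i * exp (dotp d q (k i))\<bar> \<le> 2 * (exp \<rho> * sqrt (real (card S))) \<and>
     vnorm d (signed_sum d k v S \<sigma> q) \<le> 2 * (exp \<rho> * sqrt (real (card S))))"
proof -
  obtain \<sigma> where \<sigma>: "\<forall>i\<in>S. \<bar>\<sigma> i\<bar> = 1" "\<And>q. vnorm d q \<le> \<rho> \<Longrightarrow>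
     vnorm (Suc d) (signed_sum d k (\<lambda>i. augment d (v i)) S \<sigma> q) \<le> exp \<rho> * sqrt (real (card S))"
    using dimension_free_signs_bound[of \<rho> S d k "Suc d" "\<lambda>i. augment d (v i)"] assms vnorm_augment_le
    by blast
  thus ?thesis using \<sigma>(1) signed_sum_augment[OF \<sigma>(2)] by blast
qed

subsection \<open>Halving\<close>

text \<open>The indicator of \<open>\<sigma> i = \<tau>\<close> is
  \<open>(1 + \<tau> * \<sigma> i) / 2\<close>.\<close>

lemma sum_sign_class:
  fixes \<sigma> :: "'a \<Rightarrow> real"
  assumes "finite I" "\<And>i. i \<in> I \<Longrightarrow> \<bar>\<sigma> i\<bar> = 1" "\<bar>\<tau>\<bar> = 1"
  shows "2 * (\<Sum>i\<in>{i \<in> I. \<sigma> i = \<tau>}. f i) = (\<Sum>i\<in>I. f i) + \<tau> * (\<Sum>i\<in>I. \<sigma> i * f i)"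
proof -
  have "2 * (\<Sum>i\<in>{i \<in> I. \<sigma> i = \<tau>}. f i) = (\<Sum>i\<in>I. if \<sigma> i = \<tau> then 2 * f i else 0)"
    using assms(1) by (auto simp: sum_distrib_left sum.inter_filter intro!: sum.cong)
  also have "\<dots> = (\<Sum>i\<in>I. f i + \<tau> * (\<sigma> i * f i))"
  proof (intro sum.cong refl)
    fix i assume "i \<in> I"
    hence "\<bar>\<sigma> i\<bar> = 1" using assms(2) by simp
    thus "(if \<sigma> i = \<tau> then 2 * f i else 0) = f i + \<tau> * (\<sigma> i * f i)"
      using assms(3) by (cases "\<sigma> i \<ge> 0"; cases "\<tau> \<ge> 0") auto
  qed
  finally show ?thesis by (simp add: sum.distrib sum_distrib_left)
qed

lemma ex_small_sign_class:
  fixes \<sigma> :: "'a \<Rightarrow> real"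
  assumes "finite I" "\<And>i. i \<in> I \<Longrightarrow> \<bar>\<sigma> i\<bar> = 1"
  obtains \<tau> :: real where "\<bar>\<tau>\<bar> = 1" "2 * card {i \<in> I. \<sigma> i = \<tau>} \<le> card I"
proof -
  have "I = {i \<in> I. \<sigma> i = 1} \<union> {i \<in> I. \<sigma> i = - 1}" using assms(2) by (force simp: abs_if split: if_splits)
  hence "card I = card {i \<in> I. \<sigma> i = 1} + card {i \<in> I. \<sigma> i = - 1}"
    using assms(1) by (subst (1) \<open>I = _\<close>, subst card_Un_disjoint) auto
  hence "2 * card {i \<in> I. \<sigma> i = 1} \<le> card I \<or> 2 * card {i \<in> I. \<sigma> i = - 1} \<le> card I" by linarith
  thus ?thesis using that[of 1] that[of "-1"] by auto
qed

text \<open>Round \<open>s\<close> carries weight \<open>2 ^ s\<close>, which amplifies its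
  discrepancy. \<open>D\<close> may vary with the round because greedy discrepancy shrinks with the
  surviving set.\<close>

lemma iterated_halving:
  assumes fin: "finite I0"
    and signs: "\<And>s S. S \<subseteq> I0 \<Longrightarrow> card S * 2 ^ s \<le> card I0 \<Longrightarrow>
      \<exists>\<sigma>. (\<forall>i\<in>S. \<bar>\<sigma> i\<bar> = 1) \<and> (\<forall>q. vnorm d q \<le> \<rho> \<longrightarrow>
        \<bar>\<Sum>i\<in>S. \<sigma> i * exp (dotp d q (k i))\<bar> \<le> D s \<and> vnorm d (signed_sum d k v S \<sigma> q) \<le> D s)"
  shows "\<exists>I\<subseteq>I0. card I * 2 ^ t \<le> card I0 \<and> (\<forall>q. vnorm d q \<le> \<rho> \<longrightarrow>
     \<bar>2 ^ t * (\<Sum>i\<in>I. exp (dotp d q (k i))) - (\<Sum>i\<in>I0. exp (dotp d q (k i)))\<bar> \<le> (\<Sum>s<t. 2 ^ s * D s) \<and>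
     vnorm d (\<lambda>j. 2 ^ t * (\<Sum>i\<in>I. exp (dotp d q (k i)) * v i j) - (\<Sum>i\<in>I0. exp (dotp d q (k i)) * v i j))
       \<le> (\<Sum>s<t. 2 ^ s * D s))"
proof (induction t)
  case 0
  show ?case by (intro exI[of _ I0]) (simp add: vnorm_def dotp_def)
next
  case (Suc t)
  then obtain I where I: "I \<subseteq> I0" "card I * 2 ^ t \<le> card I0"
    and E: "\<And>q. vnorm d q \<le> \<rho> \<Longrightarrow>
     \<bar>2 ^ t * (\<Sum>i\<in>I. exp (dotp d q (k i))) - (\<Sum>i\<in>I0. exp (dotp d q (k i)))\<bar> \<le> (\<Sum>s<t. 2 ^ s * D s)"
     "\<And>q. vnorm d q \<le> \<rho> \<Longrightarrow>
     vnorm d (\<lambda>j. 2 ^ t * (\<Sum>i\<in>I. exp (dotp d q (k i)) * v i j) - (\<Sum>i\<in>I0. exp (dotp d q (k i)) * v i j))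
       \<le> (\<Sum>s<t. 2 ^ s * D s)" by blast
  have finI: "finite I" using I fin finite_subset by blast
  obtain \<sigma> where \<sigma>: "\<forall>i\<in>I. \<bar>\<sigma> i\<bar> = 1"
    "\<And>q. vnorm d q \<le> \<rho> \<Longrightarrow> \<bar>\<Sum>i\<in>I. \<sigma> i * exp (dotp d q (k i))\<bar> \<le> D t"
    "\<And>q. vnorm d q \<le> \<rho> \<Longrightarrow> vnorm d (signed_sum d k v I \<sigma> q) \<le> D t"
    using signs[OF I] by blast
  obtain \<tau> :: real where \<tau>: "\<bar>\<tau>\<bar> = 1" "2 * card {i \<in> I. \<sigma> i = \<tau>} \<le> card I"
    using ex_small_sign_class[OF finI, of \<sigma>] \<sigma>(1) by blast
  define J where "J = {i \<in> I. \<sigma> i = \<tau>}"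
  have half: "2 * (\<Sum>i\<in>J. f i) = (\<Sum>i\<in>I. f i) + \<tau> * (\<Sum>i\<in>I. \<sigma> i * f i)" for f
    unfolding J_def using \<sigma>(1) \<tau>(1) by (intro sum_sign_class[OF finI]) auto
  have step: "2 ^ Suc t * (\<Sum>i\<in>J. f i) = 2 ^ t * (\<Sum>i\<in>I. f i) + \<tau> * 2 ^ t * (\<Sum>i\<in>I. \<sigma> i * f i)" for f
  proof -
    have "2 ^ Suc t * (\<Sum>i\<in>J. f i) = 2 ^ t * (2 * (\<Sum>i\<in>J. f i))" by simp
    also have "\<dots> = 2 ^ t * (\<Sum>i\<in>I. f i) + \<tau> * 2 ^ t * (\<Sum>i\<in>I. \<sigma> i * f i)"
      unfolding half by (simp add: algebra_simps)
    finally show ?thesis .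
  qed
  have "card J * 2 ^ Suc t = 2 * card J * 2 ^ t" by simp
  also have "\<dots> \<le> card I * 2 ^ t" using \<tau>(2) by (intro mult_right_mono) (auto simp: J_def)
  also note I(2)
  finally have card: "card J * 2 ^ Suc t \<le> card I0" .
  have bounds: "\<bar>2 ^ Suc t * (\<Sum>i\<in>J. exp (dotp d q (k i))) - (\<Sum>i\<in>I0. exp (dotp d q (k i)))\<bar> \<le> (\<Sum>s<Suc t. 2 ^ s * D s) \<and>
     vnorm d (\<lambda>j. 2 ^ Suc t * (\<Sum>i\<in>J. exp (dotp d q (k i)) * v i j) - (\<Sum>i\<in>I0. exp (dotp d q (k i)) * v i j))
       \<le> (\<Sum>s<Suc t. 2 ^ s * D s)" if q: "vnorm d q \<le> \<rho>" for q
  proof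
    have "\<bar>2 ^ Suc t * (\<Sum>i\<in>J. exp (dotp d q (k i))) - (\<Sum>i\<in>I0. exp (dotp d q (k i)))\<bar> \<le>
        \<bar>2 ^ t * (\<Sum>i\<in>I. exp (dotp d q (k i))) - (\<Sum>i\<in>I0. exp (dotp d q (k i)))\<bar> +
        \<bar>\<tau> * 2 ^ t * (\<Sum>i\<in>I. \<sigma> i * exp (dotp d q (k i)))\<bar>"
      unfolding step by linarith
    also have "\<bar>\<tau> * 2 ^ t * (\<Sum>i\<in>I. \<sigma> i * exp (dotp d q (k i)))\<bar> \<le> 2 ^ t * D t"
      using \<tau>(1) \<sigma>(2)[OF q] by (simp add: abs_mult)
    also note E(1)[OF q]
    finally show "\<bar>2 ^ Suc t * (\<Sum>i\<in>J. exp (dotp d q (k i))) - (\<Sum>i\<in>I0. exp (dotp d q (k i)))\<bar> \<le>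
        (\<Sum>s<Suc t. 2 ^ s * D s)" by simp
    have "(\<lambda>j. 2 ^ Suc t * (\<Sum>i\<in>J. exp (dotp d q (k i)) * v i j) - (\<Sum>i\<in>I0. exp (dotp d q (k i)) * v i j)) =
      (\<lambda>j. (2 ^ t * (\<Sum>i\<in>I. exp (dotp d q (k i)) * v i j) - (\<Sum>i\<in>I0. exp (dotp d q (k i)) * v i j)) +
         \<tau> * 2 ^ t * signed_sum d k v I \<sigma> q j)"
      unfolding step signed_sum_def by (intro ext) (simp add: mult.assoc)
    hence "vnorm d (\<lambda>j. 2 ^ Suc t * (\<Sum>i\<in>J. exp (dotp d q (k i)) * v i j) - (\<Sum>i\<in>I0. exp (dotp d q (k i)) * v i j)) \<le>
      vnorm d (\<lambda>j. 2 ^ t * (\<Sum>i\<in>I. exp (dotp d q (k i)) * v i j) - (\<Sum>i\<in>I0. exp (dotp d q (k i)) * v i j)) +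
      vnorm d (\<lambda>j. \<tau> * 2 ^ t * signed_sum d k v I \<sigma> q j)"
      using vnorm_triangle[of d "\<lambda>j. 2 ^ t * (\<Sum>i\<in>I. exp (dotp d q (k i)) * v i j) - (\<Sum>i\<in>I0. exp (dotp d q (k i)) * v i j)"
          "\<lambda>j. \<tau> * 2 ^ t * signed_sum d k v I \<sigma> q j"] by simp
    also have "vnorm d (\<lambda>j. \<tau> * 2 ^ t * signed_sum d k v I \<sigma> q j) \<le> 2 ^ t * D t"
      unfolding vnorm_scale using \<tau>(1) \<sigma>(3)[OF q] by (simp add: abs_mult)
    also note E(2)[OF q]
    finally show "vnorm d (\<lambda>j. 2 ^ Suc t * (\<Sum>i\<in>J. exp (dotp d q (k i)) * v i j) - (\<Sum>i\<in>I0. exp (dotp d q (k i)) * v i j))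
       \<le> (\<Sum>s<Suc t. 2 ^ s * D s)" by simp
  qed
  have "J \<subseteq> I0" using I(1) by (auto simp: J_def)
  thus ?case using card bounds by blast
qed

section \<open>Stability of attention\<close>

lemma vnorm_attn_le_1:
  assumes "finite I" "\<And>i. i \<in> I \<Longrightarrow> vnorm d (v i) \<le> 1"
  shows "vnorm d (attn d q k v I) \<le> 1"
proof (cases "I = {}")
  \<comment> \<open>Division by zero makes \<open>attn\<close> the zero vector here.\<close>
  case True thus ?thesis by (simp add: attn_def vnorm_def dotp_def)
next
  case False
  define W where "W = (\<Sum>i\<in>I. exp (dotp d q (k i)))"
  have W: "W > 0" unfolding W_def using assms False by (intro sum_pos) auto
  have "attn d q k v I = (\<lambda>j. 1 / W * (\<Sum>i\<in>I. exp (dotp d q (k i)) * v i j))"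
    by (simp add: attn_def W_def)
  hence "vnorm d (attn d q k v I) = 1 / W * vnorm d (\<lambda>j. \<Sum>i\<in>I. exp (dotp d q (k i)) * v i j)"
    using W by (simp only: vnorm_scale) simp
  also have "vnorm d (\<lambda>j. \<Sum>i\<in>I. exp (dotp d q (k i)) * v i j) \<le> (\<Sum>i\<in>I. vnorm d (\<lambda>j. exp (dotp d q (k i)) * v i j))"
    by (rule vnorm_sum_le[OF assms(1)])
  also have "\<dots> \<le> W" unfolding W_def vnorm_scale using assms(2)
    by (intro sum_mono) (simp add: mult_le_cancel_left1)
  finally show ?thesis using W by (simp add: divide_right_mono)
qed

text \<open>The error of the denominator multiplies \<open>attn\<close> of the coreset, whose norm
  is at most \<open>1\<close>, so a lower bound on \<open>W0\<close> alone suffices.\<close>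

lemma attn_error_le:
  fixes I I0 :: "nat set" and q :: "nat \<Rightarrow> real" and k v :: "nat \<Rightarrow> nat \<Rightarrow> real"
  assumes fin: "finite I" and v: "\<And>i. i \<in> I \<Longrightarrow> vnorm d (v i) \<le> 1"
  defines "W0 \<equiv> (\<Sum>i\<in>I0. exp (dotp d q (k i)))"
  assumes W0: "W0 > 0"
    and den: "\<bar>T * (\<Sum>i\<in>I. exp (dotp d q (k i))) - W0\<bar> \<le> E"
    and num: "vnorm d (\<lambda>j. T * (\<Sum>i\<in>I. exp (dotp d q (k i)) * v i j) - (\<Sum>i\<in>I0. exp (dotp d q (k i)) * v i j)) \<le> E"
  shows "vnorm d (\<lambda>j. attn d q k v I0 j - attn d q k v I j) \<le> 2 * E / W0"
proof -
  define W where "W = (\<Sum>i\<in>I. exp (dotp d q (k i)))"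
  define V V0 where "V j = (\<Sum>i\<in>I. exp (dotp d q (k i)) * v i j)"
    and "V0 j = (\<Sum>i\<in>I0. exp (dotp d q (k i)) * v i j)" for j
  have split: "attn d q k v I0 j - attn d q k v I j =
      (- 1 / W0) * (T * V j - V0 j) + ((T * W - W0) / W0) * attn d q k v I j" for j
  proof (cases "I = {}")
    case True
    thus ?thesis using W0 by (simp add: attn_def V_def V0_def W_def W0_def)
  next
    case False
    hence "W > 0" unfolding W_def using fin by (intro sum_pos) auto
    moreover have "attn d q k v I0 j = V0 j / W0" "attn d q k v I j = V j / W"
      by (simp_all add: attn_def V_def V0_def W_def W0_def)
    ultimately show ?thesis using W0 by (simp add: field_simps)
  qed
  have "vnorm d (\<lambda>j. attn d q k v I0 j - attn d q k v I j) \<le>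
      vnorm d (\<lambda>j. (- 1 / W0) * (T * V j - V0 j)) + vnorm d (\<lambda>j. ((T * W - W0) / W0) * attn d q k v I j)"
    unfolding split by (rule vnorm_triangle)
  also have "\<dots> = \<bar>- 1 / W0\<bar> * vnorm d (\<lambda>j. T * V j - V0 j) + \<bar>(T * W - W0) / W0\<bar> * vnorm d (attn d q k v I)"
    by (simp only: vnorm_scale)
  also have "\<dots> \<le> (1 / W0) * E + (E / W0) * 1"
    using W0 num den vnorm_attn_le_1[where q = q and k = k, OF fin v] vnorm_nonneg
    by (intro add_mono mult_mono) (auto simp: V_def V0_def W_def divide_right_mono)
  finally show ?thesis by simp
qed

section \<open>Number of halvings and coreset size\<close>

lemma ex_power2_between:
  assumes "(Y::real) \<ge> 1" obtains t :: nat where "2 ^ t \<le> Y" "Y < 2 ^ Suc t"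
proof -
  obtain n where "Y < 2 ^ n" using real_arch_pow[of 2 Y] by auto
  define m where "m = (LEAST n. Y < 2 ^ n)"
  have m: "Y < 2 ^ m" unfolding m_def by (rule LeastI) fact
  have "m \<noteq> 0" using m assms by (metis not_le power_0)
  then obtain t where t: "m = Suc t" using not0_implies_Suc by blast
  have "\<not> Y < 2 ^ t" using not_less_Least[of t "\<lambda>n. Y < 2 ^ n"] t m_def by auto
  thus ?thesis using that[of t] m t by auto
qed

text \<open>The terms grow by the factor \<open>sqrt 2\<close>, so the last one dominates; the
  induction closes since \<open>5 \<le> 4 * sqrt 2\<close>.\<close>

lemma sum_weighted_sqrt_le:
  assumes "n \<ge> 0"
  shows "(\<Sum>s<t. 2 ^ s * sqrt (n / 2 ^ s)) \<le> 4 * sqrt (n * 2 ^ t)"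
proof (induction t)
  case 0 show ?case using assms by simp
next
  case (Suc t)
  have "2 ^ t * sqrt (n / 2 ^ t) = sqrt (n * 2 ^ t)"
  proof -
    have "(2::real) ^ t = sqrt (2 ^ t) * sqrt (2 ^ t)" by simp
    thus ?thesis by (simp add: real_sqrt_mult real_sqrt_divide field_simps)
  qed
  hence "(\<Sum>s<Suc t. 2 ^ s * sqrt (n / 2 ^ s)) \<le> 5 * sqrt (n * 2 ^ t)" using Suc.IH by simp
  also have "\<dots> = sqrt (25 * (n * 2 ^ t))" by (subst real_sqrt_mult) simp
  also have "\<dots> \<le> sqrt (16 * (n * 2 ^ Suc t))" using assms by (intro real_sqrt_le_mono) simp
  also have "\<dots> = 4 * sqrt (n * 2 ^ Suc t)" by (subst real_sqrt_mult) simp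
  finally show ?case .
qed

lemma coreset_balanced:
  assumes "d > 0" "\<rho> \<ge> 1" "\<epsilon> > 0" "finite I0"
    and kv: "\<And>i. i \<in> I0 \<Longrightarrow> vnorm d (k i) \<le> 1 \<and> vnorm d (v i) \<le> 1"
    and large: "15636 * (exp \<rho> * sqrt (\<rho> * real d)) / \<epsilon> \<le> real (card I0)"
    and den: "\<And>q. vnorm d q \<le> \<rho> \<Longrightarrow> real (card I0) / 3 \<le> (\<Sum>i\<in>I0. exp (dotp d q (k i)))"
  shows "\<exists>I\<subseteq>I0. real (card I) \<le> 31272 * (exp \<rho> * sqrt (\<rho> * real d)) / \<epsilon> \<and>
    (\<forall>q. vnorm d q \<le> \<rho> \<longrightarrow> vnorm d (\<lambda>j. attn d q k v I0 j - attn d q k v I j) \<le> \<epsilon>)"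
proof -
  define X where "X = exp \<rho> * sqrt (\<rho> * real d)"
  define n where "n = real (card I0)"
  \<comment> \<open>At \<open>2 ^ t = Y\<close> the error
    \<open>2 * (2 ^ t * (2606 * X)) / (n / 3)\<close> equals \<epsilon>, with
    \<open>15636 = 6 * 2606\<close>. Rounding \<open>Y\<close> down to a power of two at most
    doubles the size bound.\<close>
  define Y where "Y = \<epsilon> * n / (15636 * X)"
  have X: "X > 0" using assms(1,2) by (simp add: X_def)
  have "15636 * X \<le> \<epsilon> * n" using large \<open>\<epsilon> > 0\<close> by (simp add: X_def n_def field_simps)
  hence "Y \<ge> 1" using X by (simp add: Y_def)
  have n: "n > 0" using \<open>15636 * X \<le> \<epsilon> * n\<close> X \<open>\<epsilon> > 0\<close> by (smt (verit) zero_less_mult_pos)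
  obtain t where t: "2 ^ t \<le> Y" "Y < 2 ^ Suc t" using ex_power2_between[OF \<open>Y \<ge> 1\<close>] .
  have signs: "\<exists>\<sigma>. (\<forall>i\<in>S. \<bar>\<sigma> i\<bar> = 1) \<and> (\<forall>q. vnorm d q \<le> \<rho> \<longrightarrow>
        \<bar>\<Sum>i\<in>S. \<sigma> i * exp (dotp d q (k i))\<bar> \<le> 2606 * X \<and> vnorm d (signed_sum d k v S \<sigma> q) \<le> 2606 * X)"
    if "S \<subseteq> I0" for S
    using ex_signs_discrepancy[of d \<rho> S k v] assms that finite_subset[OF that]
    by (simp add: X_def mult.assoc subset_iff)
  from iterated_halving[OF \<open>finite I0\<close> signs, where t = t]
  obtain I where I: "I \<subseteq> I0" "card I * 2 ^ t \<le> card I0"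
    "\<And>q. vnorm d q \<le> \<rho> \<Longrightarrow>
     \<bar>2 ^ t * (\<Sum>i\<in>I. exp (dotp d q (k i))) - (\<Sum>i\<in>I0. exp (dotp d q (k i)))\<bar> \<le> (\<Sum>s<t. 2 ^ s * (2606 * X))"
    "\<And>q. vnorm d q \<le> \<rho> \<Longrightarrow>
     vnorm d (\<lambda>j. 2 ^ t * (\<Sum>i\<in>I. exp (dotp d q (k i)) * v i j) - (\<Sum>i\<in>I0. exp (dotp d q (k i)) * v i j))
       \<le> (\<Sum>s<t. 2 ^ s * (2606 * X))" by blast
  have geo: "(\<Sum>s<t. 2 ^ s * (2606 * X)) \<le> 2 ^ t * (2606 * X)"
  proof -
    have "(\<Sum>s<t. (2::real) ^ s) \<le> 2 ^ t" by (induction t) auto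
    thus ?thesis unfolding sum_distrib_right[symmetric] using X by (intro mult_right_mono) auto
  qed
  have err: "vnorm d (\<lambda>j. attn d q k v I0 j - attn d q k v I j) \<le> \<epsilon>" if q: "vnorm d q \<le> \<rho>" for q
  proof -
    define W0 where "W0 = (\<Sum>i\<in>I0. exp (dotp d q (k i)))"
    have W0: "n / 3 \<le> W0" using den[OF q] by (simp add: n_def W0_def)
    have "vnorm d (\<lambda>j. attn d q k v I0 j - attn d q k v I j) \<le> 2 * (2 ^ t * (2606 * X)) / W0"
      unfolding W0_def using I(1) \<open>finite I0\<close> kv W0 n I(3,4)[OF q] geo
      by (intro attn_error_le[where T = "2 ^ t"]) (auto simp: W0_def intro: finite_subset)
    also have "\<dots> \<le> 2 * (2 ^ t * (2606 * X)) / (n / 3)"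
      using W0 n X by (intro divide_left_mono) auto
    also have "\<dots> = 2 ^ t * (15636 * X) / n" by simp
    also have "\<dots> \<le> Y * (15636 * X) / n" using t(1) X n by (intro divide_right_mono mult_right_mono) auto
    also have "\<dots> = \<epsilon>" using X n by (simp add: Y_def)
    finally show ?thesis .
  qed
  have "real (card I) * 2 ^ t \<le> n" using I(2) unfolding n_def by (metis of_nat_le_iff of_nat_mult of_nat_numeral of_nat_power)
  hence "real (card I) * 2 ^ Suc t \<le> 2 * n" by simp
  moreover have "real (card I) * Y \<le> real (card I) * 2 ^ Suc t" using t(2) by (intro mult_left_mono) auto
  ultimately have "real (card I) * Y \<le> 2 * n" by linarith
  hence "real (card I) * \<epsilon> * n \<le> 31272 * X * n" using X unfolding Y_def by (simp add: field_simps)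
  hence "real (card I) * \<epsilon> \<le> 31272 * X" using n by simp
  hence "real (card I) \<le> 31272 * X / \<epsilon>" using \<open>\<epsilon> > 0\<close> by (simp add: field_simps)
  thus ?thesis using I(1) err unfolding X_def by blast
qed

lemma coreset_dimension_free:
  assumes "\<rho> > 0" "\<epsilon> > 0" "finite I0"
    and kv: "\<And>i. i \<in> I0 \<Longrightarrow> vnorm d (k i) \<le> 1 \<and> vnorm d (v i) \<le> 1"
    and large: "256 * exp (4 * \<rho>) / \<epsilon>\<^sup>2 \<le> real (card I0)"
  shows "\<exists>I\<subseteq>I0. real (card I) \<le> 512 * exp (4 * \<rho>) / \<epsilon>\<^sup>2 \<and>
    (\<forall>q. vnorm d q \<le> \<rho> \<longrightarrow> vnorm d (\<lambda>j. attn d q k v I0 j - attn d q k v I j) \<le> \<epsilon>)"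
proof -
  define X where "X = exp (4 * \<rho>)"
  define n where "n = real (card I0)"
  \<comment> \<open>The denominator is only bounded below by \<open>n * exp (- \<rho>)\<close>, so
    the error bound is \<open>16 * exp (2 * \<rho>) * sqrt (2 ^ t / n)\<close>, which equals
    \<epsilon> at \<open>2 ^ t = Y\<close>.\<close>
  define Y where "Y = \<epsilon>\<^sup>2 * n / (256 * X)"
  have X: "X > 0" by (simp add: X_def)
  have "256 * X \<le> \<epsilon>\<^sup>2 * n" using large \<open>\<epsilon> > 0\<close> by (simp add: X_def n_def field_simps)
  hence "Y \<ge> 1" using X by (simp add: Y_def)
  have n: "n > 0" using \<open>256 * X \<le> \<epsilon>\<^sup>2 * n\<close> X \<open>\<epsilon> > 0\<close> by (smt (verit) zero_less_mult_pos zero_less_power)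
  obtain t where t: "2 ^ t \<le> Y" "Y < 2 ^ Suc t" using ex_power2_between[OF \<open>Y \<ge> 1\<close>] .
  define D where "D s = 2 * exp \<rho> * sqrt (n / 2 ^ s)" for s :: nat
  have signs: "\<exists>\<sigma>. (\<forall>i\<in>S. \<bar>\<sigma> i\<bar> = 1) \<and> (\<forall>q. vnorm d q \<le> \<rho> \<longrightarrow>
        \<bar>\<Sum>i\<in>S. \<sigma> i * exp (dotp d q (k i))\<bar> \<le> D s \<and> vnorm d (signed_sum d k v S \<sigma> q) \<le> D s)"
    if S: "S \<subseteq> I0" "card S * 2 ^ s \<le> card I0" for s S
  proof -
    have "real (card S) * 2 ^ s \<le> n" using S(2) unfolding n_def
      by (metis of_nat_le_iff of_nat_mult of_nat_numeral of_nat_power)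
    hence "real (card S) \<le> n / 2 ^ s" by (simp add: field_simps)
    hence "2 * (exp \<rho> * sqrt (real (card S))) \<le> D s"
      unfolding D_def by (simp add: mult_left_mono)
    moreover have "\<exists>\<sigma>. (\<forall>i\<in>S. \<bar>\<sigma> i\<bar> = 1) \<and> (\<forall>q. vnorm d q \<le> \<rho> \<longrightarrow>
     \<bar>\<Sum>i\<in>S. \<sigma> i * exp (dotp d q (k i))\<bar> \<le> 2 * (exp \<rho> * sqrt (real (card S))) \<and>
     vnorm d (signed_sum d k v S \<sigma> q) \<le> 2 * (exp \<rho> * sqrt (real (card S))))"
      using assms S finite_subset by (intro ex_signs_discrepancy_dimension_free) blast+
    ultimately show ?thesis by (meson order_trans)
  qed
  from iterated_halving[where D = D and t = t, OF \<open>finite I0\<close> signs]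
  obtain I where I: "I \<subseteq> I0" "card I * 2 ^ t \<le> card I0"
    "\<And>q. vnorm d q \<le> \<rho> \<Longrightarrow>
     \<bar>2 ^ t * (\<Sum>i\<in>I. exp (dotp d q (k i))) - (\<Sum>i\<in>I0. exp (dotp d q (k i)))\<bar> \<le> (\<Sum>s<t. 2 ^ s * D s)"
    "\<And>q. vnorm d q \<le> \<rho> \<Longrightarrow>
     vnorm d (\<lambda>j. 2 ^ t * (\<Sum>i\<in>I. exp (dotp d q (k i)) * v i j) - (\<Sum>i\<in>I0. exp (dotp d q (k i)) * v i j))
       \<le> (\<Sum>s<t. 2 ^ s * D s)" by blast
  have geo: "(\<Sum>s<t. 2 ^ s * D s) \<le> 8 * exp \<rho> * sqrt (n * 2 ^ t)"
  proof -
    have "(\<Sum>s<t. 2 ^ s * D s) = 2 * exp \<rho> * (\<Sum>s<t. 2 ^ s * sqrt (n / 2 ^ s))"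
      by (simp add: D_def sum_distrib_left mult_ac)
    also have "\<dots> \<le> 2 * exp \<rho> * (4 * sqrt (n * 2 ^ t))"
      using n by (intro mult_left_mono sum_weighted_sqrt_le) auto
    finally show ?thesis by simp
  qed
  have err: "vnorm d (\<lambda>j. attn d q k v I0 j - attn d q k v I j) \<le> \<epsilon>" if q: "vnorm d q \<le> \<rho>" for q
  proof -
    define W0 where "W0 = (\<Sum>i\<in>I0. exp (dotp d q (k i)))"
    have W0: "n * exp (- \<rho>) \<le> W0"
    proof -
      have "exp (- \<rho>) \<le> exp (dotp d q (k i))" if "i \<in> I0" for i
      proof -
        have "\<bar>dotp d q (k i)\<bar> \<le> vnorm d q * vnorm d (k i)" by (rule abs_dotp_le)
        also have "\<dots> \<le> \<rho> * 1" using q kv[OF that] vnorm_nonneg \<open>\<rho> > 0\<close> by (intro mult_mono) auto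
        finally show ?thesis by simp
      qed
      hence "(\<Sum>i\<in>I0. exp (- \<rho>)) \<le> W0" unfolding W0_def by (intro sum_mono)
      thus ?thesis by (simp add: n_def)
    qed
    have pos: "n * exp (- \<rho>) > 0" using n by simp
    have "vnorm d (\<lambda>j. attn d q k v I0 j - attn d q k v I j) \<le> 2 * (8 * exp \<rho> * sqrt (n * 2 ^ t)) / W0"
      unfolding W0_def using I(1) \<open>finite I0\<close> kv W0 pos I(3,4)[OF q] geo
      by (intro attn_error_le[where T = "2 ^ t"]) (auto simp: W0_def intro: finite_subset)
    also have "\<dots> \<le> 2 * (8 * exp \<rho> * sqrt (n * 2 ^ t)) / (n * exp (- \<rho>))"
      using W0 pos n less_le_trans[OF pos W0] by (intro divide_left_mono mult_pos_pos) auto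
    also have "\<dots> \<le> 2 * (8 * exp \<rho> * sqrt (n * Y)) / (n * exp (- \<rho>))"
      using t(1) n by (intro divide_right_mono mult_left_mono real_sqrt_le_mono) auto
    also have "sqrt (n * Y) = \<epsilon> * n / (16 * exp (2 * \<rho>))"
    proof -
      have "n * Y = (\<epsilon> * n / (16 * exp (2 * \<rho>)))\<^sup>2"
        by (simp add: Y_def X_def power_divide power_mult_distrib power2_eq_square flip: exp_add)
      thus ?thesis using n \<open>\<epsilon> > 0\<close> by simp
    qed
    also have "2 * (8 * exp \<rho> * (\<epsilon> * n / (16 * exp (2 * \<rho>)))) / (n * exp (- \<rho>)) = \<epsilon>"
    proof -
      have "exp (2 * \<rho>) = exp \<rho> * exp \<rho>" by (simp flip: exp_add)
      thus ?thesis using n by (simp add: exp_minus field_simps)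
    qed
    finally show ?thesis .
  qed
  have "real (card I) * 2 ^ t \<le> n" using I(2) unfolding n_def by (metis of_nat_le_iff of_nat_mult of_nat_numeral of_nat_power)
  hence "real (card I) * 2 ^ Suc t \<le> 2 * n" by simp
  moreover have "real (card I) * Y \<le> real (card I) * 2 ^ Suc t" using t(2) by (intro mult_left_mono) auto
  ultimately have "real (card I) * Y \<le> 2 * n" by linarith
  hence "real (card I) * \<epsilon>\<^sup>2 * n \<le> 512 * X * n" using X unfolding Y_def by (simp add: field_simps)
  hence "real (card I) * \<epsilon>\<^sup>2 \<le> 512 * X" using n by simp
  hence "real (card I) \<le> 512 * X / \<epsilon>\<^sup>2" using \<open>\<epsilon> > 0\<close> by (simp add: field_simps)
  thus ?thesis using I(1) err unfolding X_def by blast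
qed

subsection \<open>Coresets for attention\<close>

text \<open>If the hypothesis on the sum of the keys is too weak to bound the denominator, then \<open>n\<close> is
  at most about \<open>sqrt d * ln n\<close>, so \<open>ln n\<close> and with it \<open>d\<close> are huge compared to \<open>exp \<rho> / \<epsilon>\<close>.\<close>

lemma dimension_large:
  assumes "c > 0" "C \<ge> c + 512 * 10 ^ 10 * c" "\<rho> \<ge> 1" "0 < \<epsilon>" "\<epsilon> < 1" "\<delta> > 0" "L \<ge> 0"
    and lower: "C * (exp \<rho> * (sqrt \<rho> * \<delta>)) / \<epsilon> < exp L"
    and upper: "exp L < \<rho> * (c * \<delta> * L)"
  shows "512 * exp (4 * \<rho>) / \<epsilon>\<^sup>2 \<le> C * (exp \<rho> * (sqrt \<rho> * \<delta>)) / \<epsilon>"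
proof -
  \<comment> \<open>Here \<delta> stands for \<open>sqrt d\<close> and \<open>L\<close> for
    \<open>ln n\<close>. Comparing \<open>lower\<close> with \<open>upper\<close> and using
    \<open>\<rho> \<le> w\<close> yields \<open>w \<le> \<epsilon> * L\<close>.\<close>
  define w where "w = exp (\<rho> / 2)"
  have ww: "exp \<rho> = w * w" by (simp add: w_def flip: exp_add)
  have w1: "w \<ge> 1" using assms(3) by (simp add: w_def)
  have C: "C \<ge> c" "C > 0" "512 * 10 ^ 10 * c \<le> C" using assms(1,2) by auto
  have rw: "\<rho> \<le> w"
  proof -
    have "1 + \<rho> / 2 + (\<rho> / 2)\<^sup>2 / 2 \<le> w"
      unfolding w_def using assms(3) by (intro exp_lower_Taylor_quadratic) auto
    moreover have "0 \<le> (\<rho> / 2 - 1)\<^sup>2" by simp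
    hence "\<rho> / 2 \<le> 1 + (\<rho> / 2)\<^sup>2 / 2" by (simp add: power2_eq_square algebra_simps)
    ultimately show ?thesis by linarith
  qed
  have "c * (exp \<rho> * (1 * \<delta>)) \<le> C * (exp \<rho> * (sqrt \<rho> * \<delta>))"
    using C assms by (intro mult_mono) auto
  also have "\<dots> \<le> exp L * \<epsilon>" using lower \<open>0 < \<epsilon>\<close> by (simp add: pos_divide_less_eq)
  also have "\<dots> \<le> \<rho> * (c * \<delta> * L) * \<epsilon>" using upper \<open>0 < \<epsilon>\<close> by (intro mult_right_mono) auto
  finally have "(c * \<delta>) * exp \<rho> \<le> (c * \<delta>) * (\<epsilon> * \<rho> * L)" by (simp add: mult_ac)
  hence "exp \<rho> \<le> \<epsilon> * \<rho> * L" using assms by simp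
  also have "\<dots> \<le> \<epsilon> * w * L" using rw assms by (intro mult_right_mono mult_left_mono) auto
  finally have "w * w \<le> w * (\<epsilon> * L)" unfolding ww by (simp add: mult_ac)
  hence w: "w \<le> \<epsilon> * L" using w1 by simp
  hence wL: "w \<le> L" "1 \<le> L"
    using mult_right_mono[of \<epsilon> 1 L] assms w1 by auto
  \<comment> \<open>The exponential beats the tenth power, which turns \<open>upper\<close> into a
    lower bound on \<delta> of order \<open>L ^ 8\<close>.\<close>
  have "(L / 10) ^ 10 \<le> (1 + L / real 10) ^ 10" using assms(7) by (intro power_mono) auto
  also have "\<dots> \<le> exp L" using assms(7) by (intro exp_ge_one_plus_x_over_n_power_n) auto
  also have "\<dots> \<le> L * (c * \<delta> * L)"
  proof -
    have "\<rho> * (c * \<delta> * L) \<le> L * (c * \<delta> * L)" using rw wL assms by (intro mult_right_mono) auto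
    thus ?thesis using upper by linarith
  qed
  finally have "L ^ 10 \<le> L * (c * \<delta> * L) * 10 ^ 10" unfolding power_divide
    by (subst (asm) pos_divide_le_eq) auto
  also have "\<dots> = 10 ^ 10 * c * \<delta> * L ^ 2" by (simp only: power2_eq_square mult_ac)
  finally have "L ^ 10 \<le> 10 ^ 10 * c * \<delta> * L ^ 2" .
  moreover have "L ^ 10 = L ^ 8 * L ^ 2" by (simp flip: power_add)
  ultimately have "L ^ 8 * L ^ 2 \<le> 10 ^ 10 * c * \<delta> * L ^ 2" by (simp only:)
  hence L8: "L ^ 8 \<le> 10 ^ 10 * c * \<delta>"
    by (rule mult_right_le_imp_le) (use wL in auto)
  \<comment> \<open>After \<open>w ^ 6 \<le> w ^ 7\<close>, one factor \<open>w\<close> supplies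
    \<epsilon>, and the rest is absorbed by \<open>L ^ 8\<close>, hence by \<delta>.\<close>
  have "512 * exp (4 * \<rho>) = 512 * w ^ 6 * exp \<rho>"
  proof -
    have "w ^ 6 = exp (3 * \<rho>)" by (simp add: w_def flip: exp_of_nat_mult)
    thus ?thesis by (simp add: flip: exp_add)
  qed
  also have "w ^ 6 \<le> w ^ 7" using w1 by (intro power_increasing) auto
  also have "w ^ 7 = w ^ 6 * w" by (simp add: eval_nat_numeral)
  also have "\<dots> \<le> L ^ 6 * (\<epsilon> * L)" using w w1 wL by (intro mult_mono power_mono) auto
  also have "\<dots> = \<epsilon> * L ^ 7" by (simp add: eval_nat_numeral)
  also have "L ^ 7 \<le> L ^ 8" using wL by (intro power_increasing) auto
  also note L8
  also have "512 * (\<epsilon> * (10 ^ 10 * c * \<delta>)) * exp \<rho> = (512 * 10 ^ 10 * c) * (\<epsilon> * (exp \<rho> * (1 * \<delta>)))" by simp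
  also have "\<dots> \<le> C * (\<epsilon> * (exp \<rho> * (sqrt \<rho> * \<delta>)))"
    using C assms by (intro mult_mono) auto
  finally have "512 * exp (4 * \<rho>) / \<epsilon>\<^sup>2 \<le> C * (\<epsilon> * (exp \<rho> * (sqrt \<rho> * \<delta>))) / \<epsilon>\<^sup>2"
    using assms by (simp add: divide_right_mono mult_left_mono mult_right_mono)
  thus ?thesis using assms by (simp add: power2_eq_square)
qed

text \<open>Jensen's inequality: the mean exponent is at least \<open>-1\<close>, and
  \<open>exp 1 \<le> 3\<close>.\<close>

lemma sum_exp_ge_of_small_mean:
  assumes "n > 0" "vnorm d q \<le> \<rho>" "\<rho> * vnorm d (\<lambda>j. \<Sum>i=1..n. k i j) \<le> real n"
  shows "real n / 3 \<le> (\<Sum>i=1..n. exp (dotp d q (k i)))"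
proof -
  have "(\<Sum>i=1..n. dotp d q (k i)) = dotp d q (\<lambda>j. \<Sum>i=1..n. k i j)"
    using dotp_sum_right[where S = "{1..n}" and w = "\<lambda>_. 1" and v = k] by simp
  moreover have "\<bar>dotp d q (\<lambda>j. \<Sum>i=1..n. k i j)\<bar> \<le> real n"
  proof -
    have "\<bar>dotp d q (\<lambda>j. \<Sum>i=1..n. k i j)\<bar> \<le> vnorm d q * vnorm d (\<lambda>j. \<Sum>i=1..n. k i j)" by (rule abs_dotp_le)
    also have "\<dots> \<le> \<rho> * vnorm d (\<lambda>j. \<Sum>i=1..n. k i j)" using assms vnorm_nonneg by (intro mult_right_mono)
    finally show ?thesis using assms by linarith
  qed
  ultimately have "-1 \<le> (\<Sum>i=1..n. dotp d q (k i)) / real n"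
    using assms(1) by (simp add: field_simps abs_le_iff)
  hence "exp (-1) \<le> exp ((\<Sum>i=1..n. dotp d q (k i)) / real n)" by simp
  hence "real n * exp (-1) \<le> real n * exp ((\<Sum>i=1..n. dotp d q (k i)) / real n)"
    by (intro mult_left_mono) auto
  also have "\<dots> \<le> (\<Sum>i=1..n. exp (dotp d q (k i)))"
    using exp_mean_le[of "{1..n}" "\<lambda>i. dotp d q (k i)"] assms(1) by simp
  also have "real n / 3 \<le> real n * exp (-1)"
    using exp_le assms(1) by (simp add: exp_minus field_simps)
  finally show ?thesis by simp
qed

lemma coreset_exists:
  assumes c0: "c0 > 0" and "d > 0" "\<rho> \<ge> 1" "0 < \<epsilon>" "\<epsilon> < 1" "n > 0"
    and kv: "\<And>i. i \<in> {1..n} \<Longrightarrow> vnorm d (k i) \<le> 1 \<and> vnorm d (v i) \<le> 1"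
    and mean: "vnorm d (\<lambda>j. \<Sum>i=1..n. k i j) \<le> c0 * sqrt (real d) * ln (real n)"
  defines "C \<equiv> 31272 + (c0 + 512 * 10 ^ 10 * c0)"
  shows "\<exists>I\<subseteq>{1..n}. real (card I) \<le> C * (exp \<rho> * (sqrt \<rho> * sqrt d)) / \<epsilon> \<and>
    (\<forall>q. vnorm d q \<le> \<rho> \<longrightarrow> vnorm d (\<lambda>j. attn d q k v {1..n} j - attn d q k v I j) \<le> \<epsilon>)"
proof -
  define X where "X = exp \<rho> * (sqrt \<rho> * sqrt d)"
  have X: "X > 0" using assms by (simp add: X_def)
  have C: "31272 \<le> C" using c0 by (simp add: C_def)
  \<comment> \<open>The whole set is small enough, or the key sum controls the denominator, or its
    bound is too weak. \<open>C\<close> adds up the constants for the last two cases.\<close>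
  consider "real n \<le> C * X / \<epsilon>"
    | "C * X / \<epsilon> < real n" "\<rho> * (c0 * sqrt d * ln n) \<le> real n"
    | "C * X / \<epsilon> < real n" "real n < \<rho> * (c0 * sqrt d * ln n)" by linarith
  thus ?thesis
  proof cases
    case 1
    thus ?thesis using \<open>0 < \<epsilon>\<close> by (intro exI[of _ "{1..n}"]) (auto simp: X_def vnorm_def dotp_def)
  next
    case 2
    have mean_le: "\<rho> * vnorm d (\<lambda>j. \<Sum>i=1..n. k i j) \<le> real n"
      using mult_left_mono[OF mean, of \<rho>] 2(2) \<open>\<rho> \<ge> 1\<close> by linarith
    have "15636 * X / \<epsilon> \<le> C * X / \<epsilon>"
      using C X \<open>0 < \<epsilon>\<close> by (intro divide_right_mono mult_right_mono) auto
    hence large: "15636 * (exp \<rho> * sqrt (\<rho> * real d)) / \<epsilon> \<le> real (card {1..n})"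
      using 2(1) by (simp add: X_def real_sqrt_mult)
    have den: "real (card {1..n}) / 3 \<le> (\<Sum>i\<in>{1..n}. exp (dotp d q (k i)))" if "vnorm d q \<le> \<rho>" for q
      using sum_exp_ge_of_small_mean[OF \<open>n > 0\<close> that mean_le] by simp
    obtain I where I: "I \<subseteq> {1..n}" "real (card I) \<le> 31272 * (exp \<rho> * sqrt (\<rho> * real d)) / \<epsilon>"
      "\<forall>q. vnorm d q \<le> \<rho> \<longrightarrow> vnorm d (\<lambda>j. attn d q k v {1..n} j - attn d q k v I j) \<le> \<epsilon>"
      using coreset_balanced[OF \<open>d > 0\<close> \<open>\<rho> \<ge> 1\<close> \<open>0 < \<epsilon>\<close> _ kv large den] by blast
    have "31272 * X / \<epsilon> \<le> C * X / \<epsilon>"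
      using C X \<open>0 < \<epsilon>\<close> by (intro divide_right_mono mult_right_mono) auto
    thus ?thesis using I by (intro exI[of _ I]) (auto simp: X_def real_sqrt_mult)
  next
    case 3
    have small: "512 * exp (4 * \<rho>) / \<epsilon>\<^sup>2 \<le> C * X / \<epsilon>"
      unfolding X_def
    proof (rule dimension_large[where c = c0 and L = "ln n"])
      show "C * (exp \<rho> * (sqrt \<rho> * sqrt (real d))) / \<epsilon> < exp (ln (real n))"
        "exp (ln (real n)) < \<rho> * (c0 * sqrt (real d) * ln (real n))"
        using 3 \<open>n > 0\<close> by (simp_all add: X_def)
    qed (use assms in \<open>auto simp: C_def\<close>)
    have "256 * exp (4 * \<rho>) / \<epsilon>\<^sup>2 \<le> 512 * exp (4 * \<rho>) / \<epsilon>\<^sup>2" by (intro divide_right_mono) auto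
    hence large: "256 * exp (4 * \<rho>) / \<epsilon>\<^sup>2 \<le> real (card {1..n})" using small 3(1) by simp
    have "\<rho> > 0" using \<open>\<rho> \<ge> 1\<close> by simp
    from coreset_dimension_free[OF this \<open>0 < \<epsilon>\<close> _ kv large] small show ?thesis
      unfolding X_def by (meson finite_atLeastAtMost order_trans)
  qed
qed

theorem theorem7:
  shows "\<exists>\<zeta> :: real \<Rightarrow> real.
     (\<lambda>\<rho>. \<zeta> \<rho> - \<rho> - ln \<rho> / 2) \<in> o[at_top](\<lambda>\<rho>. ln (ln \<rho>)) \<and>
     (\<forall>c0 > 0. \<exists>C > 0. \<forall>(d::nat) (n::nat) (\<rho>::real) (\<epsilon>::real) k v.
        \<rho> > 0 \<longrightarrow> \<epsilon> > 0 \<longrightarrow>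
        (\<forall>i\<in>{1..n}. vnorm d (k i) \<le> 1 \<and> vnorm d (v i) \<le> 1) \<longrightarrow>
        vnorm d (\<lambda>j. \<Sum>i=1..n. k i j) \<le> c0 * sqrt (real d) * ln (real n) \<longrightarrow>
        (\<exists>I \<subseteq> {1..n}.
           real (card I) \<le> C * (sqrt (real d) / \<epsilon>) * exp (\<zeta> \<rho>) \<and>
           (\<forall>q. vnorm d q \<le> \<rho> \<longrightarrow>
              vnorm d (\<lambda>j. attn d q k v {1..n} j - attn d q k v I j) \<le> \<epsilon>)))"
proof -
  \<comment> \<open>\<open>coreset_exists\<close> asks for radius at least \<open>1\<close>, so
    smaller balls are enlarged to the unit ball. For \<open>\<rho> \<ge> 1\<close> the error term
    vanishes exactly.\<close>
  define \<zeta> :: "real \<Rightarrow> real" where "\<zeta> \<rho> = max 1 \<rho> + ln (max 1 \<rho>) / 2" for \<rho>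
  have exp_\<zeta>: "exp (\<zeta> \<rho>) = exp (max 1 \<rho>) * sqrt (max 1 \<rho>)" for \<rho>
  proof -
    have "exp (ln (max 1 \<rho>) / 2) = exp (ln (sqrt (max 1 \<rho>)))" by (subst ln_sqrt) auto
    thus ?thesis unfolding \<zeta>_def exp_add by simp
  qed
  have "eventually (\<lambda>\<rho>. \<zeta> \<rho> - \<rho> - ln \<rho> / 2 = 0) at_top"
    using eventually_ge_at_top[of 1] by eventually_elim (simp add: \<zeta>_def)
  hence "eventually (\<lambda>\<rho>. norm (\<zeta> \<rho> - \<rho> - ln \<rho> / 2) \<le> c * norm (ln (ln \<rho>))) at_top" if "c > 0" for c
  proof eventually_elim
    case (elim \<rho>)
    show ?case unfolding elim using that by simp
  qed
  hence "(\<lambda>\<rho>. \<zeta> \<rho> - \<rho> - ln \<rho> / 2) \<in> o[at_top](\<lambda>\<rho>. ln (ln \<rho>))"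
    by (rule landau_o.smallI)
  moreover have "\<exists>C > 0. \<forall>(d::nat) (n::nat) (\<rho>::real) (\<epsilon>::real) k v.
        \<rho> > 0 \<longrightarrow> \<epsilon> > 0 \<longrightarrow>
        (\<forall>i\<in>{1..n}. vnorm d (k i) \<le> 1 \<and> vnorm d (v i) \<le> 1) \<longrightarrow>
        vnorm d (\<lambda>j. \<Sum>i=1..n. k i j) \<le> c0 * sqrt (real d) * ln (real n) \<longrightarrow>
        (\<exists>I \<subseteq> {1..n}.
           real (card I) \<le> C * (sqrt (real d) / \<epsilon>) * exp (\<zeta> \<rho>) \<and>
           (\<forall>q. vnorm d q \<le> \<rho> \<longrightarrow>
              vnorm d (\<lambda>j. attn d q k v {1..n} j - attn d q k v I j) \<le> \<epsilon>))" if c0: "c0 > 0" for c0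
  proof -
    define C where "C = 31272 + (c0 + 512 * 10 ^ 10 * c0)"
    have C: "C > 0" using c0 by (simp add: C_def)
    have "\<exists>I \<subseteq> {1..n}.
           real (card I) \<le> C * (sqrt (real d) / \<epsilon>) * exp (\<zeta> \<rho>) \<and>
           (\<forall>q. vnorm d q \<le> \<rho> \<longrightarrow>
              vnorm d (\<lambda>j. attn d q k v {1..n} j - attn d q k v I j) \<le> \<epsilon>)"
      if "\<rho> > 0" "\<epsilon> > 0" and kv: "\<forall>i\<in>{1..n}. vnorm d (k i) \<le> 1 \<and> vnorm d (v i) \<le> 1"
        and mean: "vnorm d (\<lambda>j. \<Sum>i=1..n. k i j) \<le> c0 * sqrt (real d) * ln (real n)"
      for d n :: nat and \<rho> \<epsilon> :: real and k v
    proof (cases "d = 0 \<or> n = 0 \<or> \<epsilon> \<ge> 1")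
      \<comment> \<open>The empty coreset has zero attention; the full attention has norm at most
        \<open>1\<close>, and norm \<open>0\<close> if \<open>d = 0\<close> or
        \<open>n = 0\<close>.\<close>
      case True
      have "vnorm d (\<lambda>j. attn d q k v {1..n} j - attn d q k v {} j) \<le> \<epsilon>" for q
      proof -
        have eq: "(\<lambda>j. attn d q k v {1..n} j - attn d q k v {} j) = attn d q k v {1..n}"
          by (simp add: attn_def)
        have "vnorm d (attn d q k v {1..n}) \<le> 1" using kv by (intro vnorm_attn_le_1) auto
        thus ?thesis unfolding eq using True \<open>\<epsilon> > 0\<close>
          by (cases "\<epsilon> \<ge> 1") (auto simp: vnorm_def dotp_def attn_def simp del: real_sqrt_le_1_iff)
      qed
      thus ?thesis using C \<open>\<epsilon> > 0\<close> by (intro exI[of _ "{}"]) auto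
    next
      case False
      obtain I where I: "I \<subseteq> {1..n}"
        "real (card I) \<le> C * (exp (max 1 \<rho>) * (sqrt (max 1 \<rho>) * sqrt d)) / \<epsilon>"
        "\<And>q. vnorm d q \<le> max 1 \<rho> \<Longrightarrow> vnorm d (\<lambda>j. attn d q k v {1..n} j - attn d q k v I j) \<le> \<epsilon>"
        using coreset_exists[OF c0, of d "max 1 \<rho>" \<epsilon> n k v] False \<open>\<epsilon> > 0\<close> kv mean
        unfolding C_def[symmetric] by auto
      have "C * (exp (max 1 \<rho>) * (sqrt (max 1 \<rho>) * sqrt d)) / \<epsilon> = C * (sqrt (real d) / \<epsilon>) * exp (\<zeta> \<rho>)"
        unfolding exp_\<zeta> by simp
      hence "real (card I) \<le> C * (sqrt (real d) / \<epsilon>) * exp (\<zeta> \<rho>)" using I(2) by (simp only:)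
      moreover have "vnorm d (\<lambda>j. attn d q k v {1..n} j - attn d q k v I j) \<le> \<epsilon>" if "vnorm d q \<le> \<rho>" for q
        using that by (intro I(3)) simp
      ultimately show ?thesis using I(1) by blast
    qed
    thus ?thesis using C by blast
  qed
  ultimately show ?thesis by blast
qed

end
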